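(* Let $n\ge 1$ and let $J$ be a left-invariant almost complex structure on the $(2n+2)$-dimensional Kodaira-Thurston manifold $KT^{2n+2}$. Then the Kodaira dimension $\kappa_J(KT^{2n+2})$ is either $0$ or $-\infty$.
   Context: The Heisenberg group $H_{2n+1}(\mathbb{R})$ is the group of $(n+2)\times(n+2)$ real matrices $\begin{pmatrix}1&x&z\\0&I_n&y\\0&0&1\end{pmatrix}$ with $x,y\in\mathbb{R}^n$ ($x$ a row, $y$ a column), $z\in\mathbb{R}$, and $H_{2n+1}(\mathbb{Z})$ is the discrete subgroup with $x,y\in\mathbb{Z}^n$, $z\in\mathbb{Z}$. The Kodaira-Thurston manifold is the compact quotient $KT^{2n+2}=(H_{2n+1}(\mathbb{Z})\times\mathbb{Z})\backslash(H_{2n+1}(\mathbb{R})\times\mathbb{R})$, where $t$ denotes the coordinate on the last factor $\mathbb{R}$. Left-invariant vector fields on the group $H_{2n+1}(\mathbb{R})\times\mathbb{R}$ descend to $KT^{2n+2}$, and these are called left-invariant vector fields on $KT^{2n+2}$. They are spanned over $\mathbb{R}$ by $\partial_{x_j}$, $\partial_{y_j}+x_j\partial_z$ ($1\le j\le n$), $\partial_z$, $\partial_t$. An almost complex structure on $KT^{2n+2}$ is left-invariant if it maps left-invariant vector fields to left-invariant vector fields, i.e. has constant coefficients in this frame. Let $(X,J)$ be a compact almost complex manifold of real dimension $2k$. The operator $\overline{\partial}$ on $(p,q)$-forms is the component of the exterior derivative $d$ mapping $(p,q)$-forms to $(p,q+1)$-forms. Let $K_J$ be the canonical bundle, i.e.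 the complex line bundle of $(k,0)$-forms. The operator $\overline{\partial}$ on smooth $(k,0)$-forms, with values in $(k,1)$-forms (identified with $(0,1)$-forms with values in $K_J$ via $\theta\otimes s\leftrightarrow\theta\wedge s$), extends by the Leibniz rule to an operator $\overline{\partial}$ from smooth sections of $K_J^{\otimes N}$ to $(0,1)$-forms with values in $K_J^{\otimes N}$, satisfying $\overline{\partial}(fs)=\overline{\partial}f\otimes s+f\,\overline{\partial}s$ for smooth functions $f$. Set $H^0(X,K_J^{\otimes N})=\{s \text{ smooth section of } K_J^{\otimes N} : \overline{\partial}s=0\}$ and $P_N=\dim_{\mathbb{C}}H^0(X,K_J^{\otimes N})$. The Kodaira dimension is $$\kappa_J(X)=\begin{cases}-\infty & \text{if } P_N=0 \text{ for all } N\ge1,\\ \limsup_{N\to\infty}\dfrac{\log P_N}{\log N} & \text{otherwise,}\end{cases}$$ with the convention $\log 0=-\infty$. *)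

theory Defs
  imports "HOL-Analysis.Analysis" "HOL-Library.Function_Algebras" "HOL-Combinatorics.Permutations"
begin

section \<open>Complex vector spaces of functions\<close>

definition cscale :: "complex \<Rightarrow> ('a \<Rightarrow> complex) \<Rightarrow> 'a \<Rightarrow> complex"
  where "cscale c f = (\<lambda>x. c * f x)"

definition cscale2 :: "complex \<Rightarrow> ('a \<Rightarrow> 'b \<Rightarrow> complex) \<Rightarrow> 'a \<Rightarrow> 'b \<Rightarrow> complex"
  where "cscale2 c f = (\<lambda>x y. c * f x y)"

interpretation cfun: vector_space "cscale :: complex \<Rightarrow> ('a \<Rightarrow> complex) \<Rightarrow> 'a \<Rightarrow> complex"
  by unfold_locales (auto simp: cscale_def fun_eq_iff algebra_simps)

interpretation cfun2: vector_space "cscale2 :: complex \<Rightarrow> ('a \<Rightarrow> 'b \<Rightarrow> complex) \<Rightarrow> 'a \<Rightarrow> 'b \<Rightarrow> complex"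
  by unfold_locales (auto simp: cscale2_def fun_eq_iff algebra_simps)

section \<open>Smooth maps\<close>

fun Ck :: "nat \<Rightarrow> ('a::euclidean_space \<Rightarrow> 'b::real_normed_vector) \<Rightarrow> bool" where
  "Ck 0 f \<longleftrightarrow> continuous_on UNIV f"
| "Ck (Suc k) f \<longleftrightarrow> (\<forall>p. f differentiable (at p)) \<and> (\<forall>v. Ck k (\<lambda>p. frechet_derivative f (at p) v))"

definition smooth_map :: "('a::euclidean_space \<Rightarrow> 'b::real_normed_vector) \<Rightarrow> bool"
  where "smooth_map f \<longleftrightarrow> (\<forall>k. Ck k f)"

section \<open>Forms of type (p,q) on a vector space with a complex structure\<close>

text \<open>
  A complex-valued m-form on a real vector space is a function of a sequence \<open>v :: nat \<Rightarrow> 'v\<close> of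
  vectors that depends only on \<open>v 0, \<dots>, v (m - 1)\<close>. In this section \<open>j\<close> is a linear map with
  \<open>j \<circ> j = - id\<close>.
\<close>

type_synonym 'v form = "(nat \<Rightarrow> 'v) \<Rightarrow> complex"

definition forms10 :: "('v::real_vector \<Rightarrow> 'v) \<Rightarrow> ('v \<Rightarrow> complex) set"
  where "forms10 j = {\<alpha>. linear \<alpha> \<and> (\<forall>v. \<alpha> (j v) = \<i> * \<alpha> v)}"

definition forms01 :: "('v::real_vector \<Rightarrow> 'v) \<Rightarrow> ('v \<Rightarrow> complex) set"
  where "forms01 j = {\<alpha>. linear \<alpha> \<and> (\<forall>v. \<alpha> (j v) = - \<i> * \<alpha> v)}"

text \<open>The wedge product \<open>\<alpha> 0 \<and> \<dots> \<and> \<alpha> (m - 1)\<close> of 1-forms, as the determinant of \<open>\<alpha> i (v l)\<close>.\<close>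

definition wedge_list :: "nat \<Rightarrow> (nat \<Rightarrow> 'v \<Rightarrow> complex) \<Rightarrow> 'v form"
  where "wedge_list m \<alpha> =
    (\<lambda>v. \<Sum>\<pi> | \<pi> permutes {..<m}. of_int (sign \<pi>) * (\<Prod>i<m. \<alpha> i (v (\<pi> i))))"

definition forms :: "('v::real_vector \<Rightarrow> 'v) \<Rightarrow> nat \<Rightarrow> nat \<Rightarrow> 'v form set"
  where "forms j p q = cfun.span {wedge_list (p + q) \<alpha> | \<alpha>.
    (\<forall>i<p. \<alpha> i \<in> forms10 j) \<and> (\<forall>i\<in>{p..<p + q}. \<alpha> i \<in> forms01 j)}"

text \<open>The (p,q)-component of a (p+q)-form, with respect to the decomposition of the space of
  (p+q)-forms as the direct sum of the \<open>forms j a b\<close> with \<open>a + b = p + q\<close>.\<close>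

definition type_part :: "('v::real_vector \<Rightarrow> 'v) \<Rightarrow> nat \<Rightarrow> nat \<Rightarrow> 'v form \<Rightarrow> 'v form"
  where "type_part j p q \<omega> = (THE \<eta>. \<eta> \<in> forms j p q \<and>
    \<omega> - \<eta> \<in> cfun.span (\<Union>(a, b) \<in> {(a, b). a + b = p + q \<and> (a, b) \<noteq> (p, q)}. forms j a b))"

section \<open>Powers of the canonical line and (0,1)-forms with values in them\<close>

text \<open>In real dimension 2k, the forms of type (k,0).\<close>

definition canon :: "('v::euclidean_space \<Rightarrow> 'v) \<Rightarrow> 'v form set"
  where "canon j = forms j (DIM('v) div 2) 0"

text \<open>
  The N-th tensor power of \<open>canon j\<close> is realised inside the functions of \<open>N\<close> blocks \<open>w 0, \<dots>, w (N - 1)\<close>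
  of vectors, block \<open>w i\<close> being the argument of the i-th tensor factor.
\<close>

definition tensor :: "nat \<Rightarrow> (nat \<Rightarrow> 'v form) \<Rightarrow> (nat \<Rightarrow> nat \<Rightarrow> 'v) \<Rightarrow> complex"
  where "tensor N \<phi> = (\<lambda>w. \<Prod>i<N. \<phi> i (w i))"

definition canon_pow :: "nat \<Rightarrow> ('v::euclidean_space \<Rightarrow> 'v) \<Rightarrow> ((nat \<Rightarrow> nat \<Rightarrow> 'v) \<Rightarrow> complex) set"
  where "canon_pow N j = cfun.span {tensor N \<phi> | \<phi>. \<forall>i<N. \<phi> i \<in> canon j}"

text \<open>(0,1)-forms with values in a space \<open>E\<close> of functions, i.e. the tensor product of
  \<open>forms01 j\<close> and \<open>E\<close>.\<close>

definition valued01 :: "('v::real_vector \<Rightarrow> 'v) \<Rightarrow> ('t \<Rightarrow> complex) set \<Rightarrow> ('v \<times> 't \<Rightarrow> complex) set"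
  where "valued01 j E = cfun.span {(\<lambda>(u, t). \<theta> u * s t) | \<theta> s. \<theta> \<in> forms01 j \<and> s \<in> E}"

definition omit :: "nat \<Rightarrow> (nat \<Rightarrow> 'v) \<Rightarrow> nat \<Rightarrow> 'v"
  where "omit i v = (\<lambda>l. if l < i then v l else v (Suc l))"

text \<open>The linear map sending \<open>\<theta> \<otimes> s\<close> to \<open>\<theta> \<and> s\<close>, for a 1-form \<open>\<theta>\<close> and a k-form \<open>s\<close>.\<close>

definition wedge_map :: "nat \<Rightarrow> ('v \<times> (nat \<Rightarrow> 'v) \<Rightarrow> complex) \<Rightarrow> 'v form"
  where "wedge_map k \<sigma> = (\<lambda>v. \<Sum>i\<le>k. (- 1) ^ i * \<sigma> (v i, omit i v))"

section \<open>Almost complex quotients of a Euclidean space\<close>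

text \<open>
  Let \<open>\<Phi>\<close> be a group of diffeomorphisms of a Euclidean space \<open>'e\<close> acting freely and properly
  discontinuously, and let \<open>X\<close> be the quotient manifold. All objects on \<open>X\<close> (functions, almost complex
  structures, sections of bundles) are given by their pullbacks to \<open>'e\<close>, which are exactly the
  \<open>\<Phi>\<close>-invariant smooth objects on \<open>'e\<close>. Every tangent space of \<open>'e\<close> is identified with \<open>'e\<close>.
\<close>

definition smooth_fun :: "('e::euclidean_space \<Rightarrow> 'e) set \<Rightarrow> ('e \<Rightarrow> complex) \<Rightarrow> bool"
  where "smooth_fun \<Phi> f \<longleftrightarrow> smooth_map f \<and> (\<forall>g\<in>\<Phi>. \<forall>p. f (g p) = f p)"

definition almost_complex_structure :: "('e::euclidean_space \<Rightarrow> 'e) set \<Rightarrow> ('e \<Rightarrow> 'e \<Rightarrow> 'e) \<Rightarrow> bool"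
  where "almost_complex_structure \<Phi> J \<longleftrightarrow>
    (\<forall>p. linear (J p) \<and> (\<forall>v. J p (J p v) = - v)) \<and>
    (\<forall>v. smooth_map (\<lambda>p. J p v)) \<and>
    (\<forall>g\<in>\<Phi>. \<forall>p v. J (g p) (frechet_derivative g (at p) v) = frechet_derivative g (at p) (J p v))"

text \<open>
  Smooth sections of the bundle with fibre \<open>E p\<close> at \<open>p\<close>, a space of functions of arguments \<open>t\<close> built
  from tangent vectors at \<open>p\<close>; \<open>act L t\<close> applies \<open>L\<close> to all the vectors making up \<open>t\<close>. Invariance
  means that the pullback of \<open>s\<close> under every \<open>g \<in> \<Phi>\<close> is \<open>s\<close>.
\<close>

definition smooth_section ::
  "('e::euclidean_space \<Rightarrow> 'e) set \<Rightarrow> (('e \<Rightarrow> 'e) \<Rightarrow> 't \<Rightarrow> 't) \<Rightarrow> ('e \<Rightarrow> ('t \<Rightarrow> complex) set) \<Rightarrow>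
   ('e \<Rightarrow> 't \<Rightarrow> complex) \<Rightarrow> bool"
  where "smooth_section \<Phi> act E s \<longleftrightarrow>
    (\<forall>p. s p \<in> E p) \<and> (\<forall>t. smooth_map (\<lambda>p. s p t)) \<and>
    (\<forall>g\<in>\<Phi>. \<forall>p t. s (g p) (act (frechet_derivative g (at p)) t) = s p t)"

definition act_form :: "('e \<Rightarrow> 'e) \<Rightarrow> (nat \<Rightarrow> 'e) \<Rightarrow> nat \<Rightarrow> 'e"
  where "act_form L v = (\<lambda>l. L (v l))"

definition act_blocks :: "('e \<Rightarrow> 'e) \<Rightarrow> (nat \<Rightarrow> nat \<Rightarrow> 'e) \<Rightarrow> nat \<Rightarrow> nat \<Rightarrow> 'e"
  where "act_blocks L w = (\<lambda>i l. L (w i l))"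

definition act_valued :: "('e \<Rightarrow> 'e) \<Rightarrow> 'e \<times> (nat \<Rightarrow> nat \<Rightarrow> 'e) \<Rightarrow> 'e \<times> (nat \<Rightarrow> nat \<Rightarrow> 'e)"
  where "act_valued L = (\<lambda>(u, w). (L u, act_blocks L w))"

definition canon_sections ::
  "('e::euclidean_space \<Rightarrow> 'e) set \<Rightarrow> ('e \<Rightarrow> 'e \<Rightarrow> 'e) \<Rightarrow> ('e \<Rightarrow> 'e form) set"
  where "canon_sections \<Phi> J = {\<phi>. smooth_section \<Phi> act_form (\<lambda>p. canon (J p)) \<phi>}"

definition pluricanon_sections ::
  "('e::euclidean_space \<Rightarrow> 'e) set \<Rightarrow> ('e \<Rightarrow> 'e \<Rightarrow> 'e) \<Rightarrow> nat \<Rightarrow> ('e \<Rightarrow> (nat \<Rightarrow> nat \<Rightarrow> 'e) \<Rightarrow> complex) set"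
  where "pluricanon_sections \<Phi> J N = {s. smooth_section \<Phi> act_blocks (\<lambda>p. canon_pow N (J p)) s}"

definition pluricanon_sections01 ::
  "('e::euclidean_space \<Rightarrow> 'e) set \<Rightarrow> ('e \<Rightarrow> 'e \<Rightarrow> 'e) \<Rightarrow> nat \<Rightarrow>
   ('e \<Rightarrow> 'e \<times> (nat \<Rightarrow> nat \<Rightarrow> 'e) \<Rightarrow> complex) set"
  where "pluricanon_sections01 \<Phi> J N =
    {s. smooth_section \<Phi> act_valued (\<lambda>p. valued01 (J p) (canon_pow N (J p))) s}"

section \<open>The operator dbar\<close>

text \<open>The exterior derivative of an m-form, by the invariant formula applied to constant vector
  fields (whose brackets vanish).\<close>

definition ext_deriv :: "nat \<Rightarrow> ('e::euclidean_space \<Rightarrow> 'e form) \<Rightarrow> 'e \<Rightarrow> 'e form"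
  where "ext_deriv m \<omega> p =
    (\<lambda>v. \<Sum>i\<le>m. (- 1) ^ i * frechet_derivative (\<lambda>q. \<omega> q (omit i v)) (at p) (v i))"

definition dbar :: "('e::euclidean_space \<Rightarrow> 'e \<Rightarrow> 'e) \<Rightarrow> nat \<Rightarrow> nat \<Rightarrow> ('e \<Rightarrow> 'e form) \<Rightarrow> 'e \<Rightarrow> 'e form"
  where "dbar J p q \<omega> x = type_part (J x) p (q + 1) (ext_deriv (p + q) \<omega> x)"

definition dbar_fun :: "('e::euclidean_space \<Rightarrow> 'e \<Rightarrow> 'e) \<Rightarrow> ('e \<Rightarrow> complex) \<Rightarrow> 'e \<Rightarrow> 'e \<Rightarrow> complex"
  where "dbar_fun J f x u = dbar J 0 0 (\<lambda>p v. f p) x (\<lambda>_. u)"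

text \<open>dbar of a (k,0)-form, seen as a (0,1)-form with values in the canonical bundle.\<close>

definition dbar_canon ::
  "('e::euclidean_space \<Rightarrow> 'e \<Rightarrow> 'e) \<Rightarrow> ('e \<Rightarrow> 'e form) \<Rightarrow> 'e \<Rightarrow> 'e \<times> (nat \<Rightarrow> 'e) \<Rightarrow> complex"
  where "dbar_canon J \<phi> x =
    the_inv_into (valued01 (J x) (canon (J x))) (wedge_map (DIM('e) div 2))
      (dbar J (DIM('e) div 2) 0 \<phi> x)"

text \<open>
  The extension of dbar to the N-th power of the canonical bundle by the Leibniz rule. Over a compact
  quotient there is such a \<open>D\<close>, and its restriction to
  \<open>pluricanon_sections \<Phi> J N\<close> is unique; its values elsewhere are irrelevant.
\<close>

definition leibniz_extension ::
  "('e::euclidean_space \<Rightarrow> 'e) set \<Rightarrow> ('e \<Rightarrow> 'e \<Rightarrow> 'e) \<Rightarrow> nat \<Rightarrow>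
   (('e \<Rightarrow> (nat \<Rightarrow> nat \<Rightarrow> 'e) \<Rightarrow> complex) \<Rightarrow> 'e \<Rightarrow> 'e \<times> (nat \<Rightarrow> nat \<Rightarrow> 'e) \<Rightarrow> complex) \<Rightarrow> bool"
  where "leibniz_extension \<Phi> J N D \<longleftrightarrow>
    (\<forall>s\<in>pluricanon_sections \<Phi> J N. D s \<in> pluricanon_sections01 \<Phi> J N) \<and>
    (\<forall>s\<in>pluricanon_sections \<Phi> J N. \<forall>s'\<in>pluricanon_sections \<Phi> J N. D (s + s') = D s + D s') \<and>
    (\<forall>f. \<forall>s\<in>pluricanon_sections \<Phi> J N. smooth_fun \<Phi> f \<longrightarrow>
      D (\<lambda>p w. f p * s p w) = (\<lambda>p (u, w). dbar_fun J f p u * s p w + f p * D s p (u, w))) \<and>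
    (\<forall>\<phi>. (\<forall>i<N. \<phi> i \<in> canon_sections \<Phi> J) \<longrightarrow>
      D (\<lambda>p. tensor N (\<lambda>i. \<phi> i p)) =
        (\<lambda>p (u, w). \<Sum>i<N. dbar_canon J (\<phi> i) p (u, w i) * (\<Prod>l\<in>{..<N} - {i}. \<phi> l p (w l))))"

definition dbar_pow ::
  "('e::euclidean_space \<Rightarrow> 'e) set \<Rightarrow> ('e \<Rightarrow> 'e \<Rightarrow> 'e) \<Rightarrow> nat \<Rightarrow>
   ('e \<Rightarrow> (nat \<Rightarrow> nat \<Rightarrow> 'e) \<Rightarrow> complex) \<Rightarrow> 'e \<Rightarrow> 'e \<times> (nat \<Rightarrow> nat \<Rightarrow> 'e) \<Rightarrow> complex"
  where "dbar_pow \<Phi> J N = (SOME D. leibniz_extension \<Phi> J N D)"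

section \<open>Plurigenera and Kodaira dimension\<close>

definition H0 ::
  "('e::euclidean_space \<Rightarrow> 'e) set \<Rightarrow> ('e \<Rightarrow> 'e \<Rightarrow> 'e) \<Rightarrow> nat \<Rightarrow> ('e \<Rightarrow> (nat \<Rightarrow> nat \<Rightarrow> 'e) \<Rightarrow> complex) set"
  where "H0 \<Phi> J N = {s \<in> pluricanon_sections \<Phi> J N. dbar_pow \<Phi> J N s = 0}"

text \<open>\<open>cfun2.dim\<close> is 0 on infinite-dimensional spaces, hence the case distinction.\<close>

definition plurigenus :: "('e::euclidean_space \<Rightarrow> 'e) set \<Rightarrow> ('e \<Rightarrow> 'e \<Rightarrow> 'e) \<Rightarrow> nat \<Rightarrow> enat"
  where "plurigenus \<Phi> J N =
    (if \<exists>B. finite B \<and> H0 \<Phi> J N \<subseteq> cfun2.span B then enat (cfun2.dim (H0 \<Phi> J N)) else \<infinity>)"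

definition log_enat :: "enat \<Rightarrow> ereal"
  where "log_enat m = (case m of enat k \<Rightarrow> if k = 0 then - \<infinity> else ereal (ln (real k)) | \<infinity> \<Rightarrow> \<infinity>)"

definition kodaira_dim :: "('e::euclidean_space \<Rightarrow> 'e) set \<Rightarrow> ('e \<Rightarrow> 'e \<Rightarrow> 'e) \<Rightarrow> ereal"
  where "kodaira_dim \<Phi> J =
    (if \<forall>N\<ge>1. plurigenus \<Phi> J N = 0 then - \<infinity>
     else limsup (\<lambda>N. log_enat (plurigenus \<Phi> J N) / ereal (ln (real N))))"

section \<open>The Kodaira-Thurston manifold\<close>

text \<open>Rows and columns are indexed by \<open>unit + 'n + unit\<close>, in this order.\<close>

fun heis_matrix :: "(real^'n) \<times> (real^'n) \<times> real \<Rightarrow> real^(unit + 'n + unit)^(unit + 'n + unit)" where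
  "heis_matrix (x, y, z) = (\<chi> r c. case r of
      Inl _ \<Rightarrow> (case c of Inl _ \<Rightarrow> 1 | Inr (Inl i) \<Rightarrow> x $ i | Inr (Inr _) \<Rightarrow> z)
    | Inr (Inl i) \<Rightarrow> (case c of Inl _ \<Rightarrow> 0 | Inr (Inl l) \<Rightarrow> if i = l then 1 else 0 | Inr (Inr _) \<Rightarrow> y $ i)
    | Inr (Inr _) \<Rightarrow> (case c of Inl _ \<Rightarrow> 0 | Inr (Inl _) \<Rightarrow> 0 | Inr (Inr _) \<Rightarrow> 1))"

text \<open>The point \<open>(x, y, z, t)\<close> stands for \<open>(heis_matrix (x, y, z), t)\<close> in the product of the Heisenberg
  group and the real line.\<close>

type_synonym 'n kt = "(real^'n) \<times> (real^'n) \<times> real \<times> real"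

fun kt_mult :: "'n::finite kt \<Rightarrow> 'n kt \<Rightarrow> 'n kt" where
  "kt_mult (x, y, z, t) (x', y', z', t') = (x + x', y + y', z + z' + x \<bullet> y', t + t')"

lemma heis_matrix_mult:
  assumes "kt_mult (x, y, z, t) (x', y', z', t') = (x'', y'', z'', t'')"
  shows "heis_matrix (x'', y'', z'') = heis_matrix (x, y, z) ** heis_matrix (x', y', z')"
proof -
  have S: "(\<Sum>k\<in>UNIV. F k) = F (Inl ()) + ((\<Sum>i\<in>UNIV. F (Inr (Inl i))) + F (Inr (Inr ())))"
    for F :: "unit + 'a + unit \<Rightarrow> real"
    by (simp add: UNIV_Plus_UNIV[symmetric] Plus_def sum.union_disjoint sum.reindex
        image_Int[symmetric] disjoint_iff image_iff UNIV_unit)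
  have x'': "x'' = x + x'" "y'' = y + y'" "z'' = z + z' + (\<Sum>i\<in>UNIV. x $ i * y' $ i)"
    using assms by (auto simp: inner_vec_def)
  have If: "(if P then a else b) * c = (if P then a * c else b * c)"
    "c * (if P then a else b) = (if P then c * a else c * b)" for P and a b c :: real
    by auto
  show ?thesis
    unfolding x'' by (auto simp: vec_eq_iff matrix_matrix_mult_def S If cong: if_cong split: sum.splits)
qed

lemma inj_heis_matrix: "inj heis_matrix"
proof (rule injI)
  fix a b :: "(real^'n) \<times> (real^'n) \<times> real" assume eq: "heis_matrix a = heis_matrix b"
  obtain x y z x' y' z' where ab: "a = (x, y, z)" "b = (x', y', z')"
    by (metis surj_pair)
  have *: "heis_matrix (x, y, z) $ r $ c = heis_matrix (x', y', z') $ r $ c" for r c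
    using eq ab by simp
  have "x $ i = x' $ i" "y $ i = y' $ i" for i
    using *[of "Inl ()" "Inr (Inl i)"] *[of "Inr (Inl i)" "Inr (Inr ())"] by simp_all
  then show "a = b"
    using *[of "Inl ()" "Inr (Inr ())"] ab by (simp add: vec_eq_iff)
qed

definition kt_lattice :: "('n::finite kt) set"
  where "kt_lattice = {(x, y, z, t). (\<forall>i. x $ i \<in> \<int>) \<and> (\<forall>i. y $ i \<in> \<int>) \<and> z \<in> \<int> \<and> t \<in> \<int>}"

text \<open>The deck group of the Kodaira-Thurston manifold, given by the left translations by lattice
  elements.\<close>

definition KT :: "('n::finite kt \<Rightarrow> 'n kt) set"
  where "KT = kt_mult ` kt_lattice"

definition left_invariant_field :: "('n::finite kt \<Rightarrow> 'n kt) \<Rightarrow> bool"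
  where "left_invariant_field V \<longleftrightarrow>
    (\<forall>g p. V (kt_mult g p) = frechet_derivative (kt_mult g) (at p) (V p))"

definition left_invariant_acs :: "('n::finite kt \<Rightarrow> 'n kt \<Rightarrow> 'n kt) \<Rightarrow> bool"
  where "left_invariant_acs J \<longleftrightarrow>
    almost_complex_structure KT J \<and>
    (\<forall>V. left_invariant_field V \<longrightarrow> left_invariant_field (\<lambda>p. J p (V p)))"

lemma frechet_derivative_kt_mult:
  "frechet_derivative (kt_mult (x, y, z, t)) (at p) (a, b, c, e) = (a, b, c + x \<bullet> b, e)"
proof -
  have eq: "kt_mult (x, y, z, t) =
      (\<lambda>q. (x + fst q, y + fst (snd q), z + fst (snd (snd q)) + x \<bullet> fst (snd q), t + snd (snd (snd q))))"
    by (auto simp: fun_eq_iff)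
  have "(kt_mult (x, y, z, t) has_derivative
      (\<lambda>q. (fst q, fst (snd q), fst (snd (snd q)) + x \<bullet> fst (snd q), snd (snd (snd q))))) (at p)"
    unfolding eq by (auto intro!: derivative_eq_intros)
  from frechet_derivative_at[OF this, symmetric] show ?thesis
    by simp
qed

text \<open>The left-invariant fields are the constant-coefficient combinations of the standard frame.\<close>

lemma left_invariant_field_iff:
  "left_invariant_field V \<longleftrightarrow> (\<exists>a b c e. \<forall>x y z t. V (x, y, z, t) = (a, b, c + x \<bullet> b, e))"
proof
  assume L: "left_invariant_field V"
  obtain a b c e where 0: "V (0, 0, 0, 0) = (a, b, c, e)"
    by (metis surj_pair)
  have "V (x, y, z, t) = (a, b, c + x \<bullet> b, e)" for x y z t
    using L[unfolded left_invariant_field_def, rule_format, of "(x, y, z, t)" "(0, 0, 0, 0)"]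
    by (simp add: 0 frechet_derivative_kt_mult)
  then show "\<exists>a b c e. \<forall>x y z t. V (x, y, z, t) = (a, b, c + x \<bullet> b, e)"
    by blast
next
  assume "\<exists>a b c e. \<forall>x y z t. V (x, y, z, t) = (a, b, c + x \<bullet> b, e)"
  then show "left_invariant_field V"
    by (auto simp: left_invariant_field_def frechet_derivative_kt_mult inner_add_left)
qed

end

(*
  A left-invariant (n+1,0)-form Omega trivialises the canonical bundle, and dbar Omega = theta /\ Omega
  for a left-invariant (0,1)-form theta. A holomorphic section of the N-th power is thus f Omega^N with
  (V + i J V) f = c(V) f for all left-invariant V, where f is a bounded function on the group and
  c(V) = - 2 N theta(V).

  Let A = d/dz, a central field. Since theta(V) is a multiple of w(V, J A) + i w(J V, J A), where w is the
  sum of the dx_j /\ dy_j, theta(A) = 0. As A and J A commute, f is bounded and holomorphic along the leaves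
  that they span, and A f = 0 by Liouville. Hence f is a function of (x, y, t), on which left-invariant
  fields act with constant coefficients; along the planes spanned by V and J V, Liouville now shows
  that f is a constant multiple of a unitary character determined by c(V). So f(v) = f(0) chi(v)
  with chi depending only on N, and all plurigenera are 0 or 1. Powers of a solution for N are
  solutions for the multiples of N.
*)

theory Submission
  imports Defs "Jordan_Normal_Form.Determinant" "HOL-Complex_Analysis.Cauchy_Integral_Formula"
begin

text \<open>The form theta comes from a structure equation. \<open>fibre\<close> spans the common
  kernel of all dx_j, dy_j and dt, so in a basis of (1,0)-forms dual to a complex basis starting
  with \<open>fibre\<close>, only the member of index 0 extends to a non-closed invariant form,
  whose differential is minus the sum of the dx_j \<and> dy_j. Sorting that 2-form by type yields
  theta. J need not be integrable: d Omega may have an (n,2)-part, and holomorphic coordinates may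
  not exist. Hence Liouville is applied along single complex curves only. The centre has to be
  treated before the other directions, since the invariant fields d/dy_j + x_j d/dz have variable
  coefficients as long as A f is not known to vanish. Three notions in the definition of H0 are
  given by description or choice: the (p,q)-component, the inverse of the wedge map, and the Leibniz
  extension. Each becomes computable only through a uniqueness result.\<close>

section \<open>Wedge products of 1-forms as determinants\<close>

lemma wedge_list_det:
  "wedge_list m \<alpha> v = Determinant.det (Matrix.mat m m (\<lambda>(i, l). \<alpha> i (v l)))"
proof -
  have "(\<Prod>i<m. \<alpha> i (v (\<pi> i))) = (\<Prod>i = 0..<m. Matrix.mat m m (\<lambda>(i, l). \<alpha> i (v l)) $$ (i, \<pi> i))"
    if "\<pi> permutes {..<m}" for \<pi>
    using permutes_in_image[OF that] by (auto simp: atLeast0LessThan intro!: prod.cong)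
  then show ?thesis
    by (simp add: wedge_list_def Determinant.det_def atLeast0LessThan)
qed

lemma wedge_list_cong:
  assumes "\<And>i l. i < m \<Longrightarrow> l < m \<Longrightarrow> \<alpha> i (v l) = \<beta> i (w l)"
  shows "wedge_list m \<alpha> v = wedge_list m \<beta> w"
  unfolding wedge_list_det using assms
  by (intro arg_cong[where f = Determinant.det] eq_matI) auto

text \<open>Laplace expansion along row 0. The alternating sum over omitted arguments has the shape
  of \<open>wedge_map\<close> and \<open>ext_deriv\<close>, which are turned into wedge products
  through it.\<close>

lemma wedge_list_case_nat:
  "wedge_list (Suc m) (case_nat \<beta> \<alpha>) v = (\<Sum>i\<le>m. (- 1) ^ i * (\<beta> (v i) * wedge_list m \<alpha> (omit i v)))"
proof -
  let ?A = "Matrix.mat (Suc m) (Suc m) (\<lambda>(i, l). case_nat \<beta> \<alpha> i (v l))"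
  have "mat_delete ?A 0 l = Matrix.mat m m (\<lambda>(i, r). \<alpha> i (omit l v r))" if "l \<le> m" for l
    using that by (intro eq_matI) (auto simp: mat_delete_def omit_def)
  then show ?thesis
    unfolding wedge_list_det
    by (subst laplace_expansion_row[of _ "Suc m" 0])
       (auto simp: cofactor_def lessThan_Suc_atMost intro!: sum.cong)
qed

lemma wedge_map_wedge_list:
  "wedge_map m (\<lambda>(u, t). \<beta> u * wedge_list m \<alpha> t) = wedge_list (Suc m) (case_nat \<beta> \<alpha>)"
  by (auto simp: wedge_map_def wedge_list_case_nat fun_eq_iff)

lemma wedge_list_permute:
  assumes "\<pi> permutes {..<m}"
  shows "wedge_list m (\<alpha> \<circ> \<pi>) v = of_int (sign \<pi>) * wedge_list m \<alpha> v"
proof -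
  let ?A = "Matrix.mat m m (\<lambda>(i, l). \<alpha> i (v l))"
  have "Matrix.mat m m (\<lambda>(i, l). (\<alpha> \<circ> \<pi>) i (v l)) = Matrix.mat m m (\<lambda>(i, l). ?A $$ (\<pi> i, l))"
    using permutes_in_image[OF assms] by (intro eq_matI) auto
  then show ?thesis
    unfolding wedge_list_det using det_permute_rows[of ?A m \<pi>] assms
    by (simp add: atLeast0LessThan)
qed

lemma wedge_list_swap:
  "wedge_list (Suc (Suc m)) (case_nat \<beta> (case_nat \<gamma> \<alpha>)) v = - wedge_list (Suc (Suc m)) (case_nat \<gamma> (case_nat \<beta> \<alpha>)) v"
proof -
  let ?\<tau> = "Transposition.transpose 0 (Suc 0)"
  have \<tau>: "?\<tau> permutes {..<Suc (Suc m)}"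
    by (rule permutes_swap_id) auto
  have "case_nat \<beta> (case_nat \<gamma> \<alpha>) = case_nat \<gamma> (case_nat \<beta> \<alpha>) \<circ> ?\<tau>"
    by (auto simp: fun_eq_iff Transposition.transpose_def split: nat.splits)
  then show ?thesis
    using wedge_list_permute[OF \<tau>, of "case_nat \<gamma> (case_nat \<beta> \<alpha>)" v] by (simp add: sign_swap_id)
qed

lemma wedge_list_triangular:
  assumes "\<And>i l. l < i \<Longrightarrow> i < m \<Longrightarrow> \<alpha> i (v l) = 0"
  shows "wedge_list m \<alpha> v = (\<Prod>i<m. \<alpha> i (v i))"
proof -
  let ?A = "Matrix.mat m m (\<lambda>(i, l). \<alpha> i (v l))"
  have "wedge_list m \<alpha> v = prod_list (diag_mat ?A)"
    unfolding wedge_list_det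
    by (rule det_upper_triangular[of _ m]) (auto intro!: upper_triangularI simp: assms)
  then show ?thesis
    by (simp add: prod_list_diag_prod atLeast0LessThan)
qed

text \<open>Multiplicativity of the determinant: by the hypothesis the matrix of \<beta> on
  \<open>v\<close> is the matrix of \<beta> on \<open>e\<close> times the matrix of \<alpha> on
  \<open>v\<close>.\<close>

lemma wedge_list_change_basis:
  assumes "\<And>i l. i < m \<Longrightarrow> l < m \<Longrightarrow> \<beta> i (v l) = (\<Sum>r<m. \<beta> i (e r) * \<alpha> r (v l))"
  shows "wedge_list m \<beta> v = wedge_list m \<beta> e * wedge_list m \<alpha> v"
proof -
  have "Matrix.mat m m (\<lambda>(i, l). \<beta> i (v l)) =
      Matrix.mat m m (\<lambda>(i, l). \<beta> i (e l)) * Matrix.mat m m (\<lambda>(i, l). \<alpha> i (v l))"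
    using assms by (intro eq_matI) (auto simp: scalar_prod_def atLeast0LessThan)
  then show ?thesis
    unfolding wedge_list_det by (simp add: det_mult[of _ m])
qed

lemma wedge_list_case_nat_sum:
  "wedge_list (Suc m) (case_nat (\<lambda>u. \<Sum>i\<in>I. c i * \<beta> i u) \<alpha>) v =
    (\<Sum>i\<in>I. c i * wedge_list (Suc m) (case_nat (\<beta> i) \<alpha>) v)"
  unfolding wedge_list_case_nat
  by (subst sum_distrib_left, subst sum.swap)
     (simp add: sum_distrib_left sum_distrib_right mult_ac)

lemma wedge_list_case_nat_add:
  "wedge_list (Suc m) (case_nat (\<lambda>u. \<beta> u + \<gamma> u) \<alpha>) v =
    wedge_list (Suc m) (case_nat \<beta> \<alpha>) v + wedge_list (Suc m) (case_nat \<gamma> \<alpha>) v"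
  unfolding wedge_list_case_nat by (simp add: algebra_simps sum.distrib)

lemma wedge_list_case_nat_add2:
  "wedge_list (Suc (Suc m)) (case_nat \<delta> (case_nat (\<lambda>u. \<beta> u + \<gamma> u) \<alpha>)) v =
    wedge_list (Suc (Suc m)) (case_nat \<delta> (case_nat \<beta> \<alpha>)) v +
    wedge_list (Suc (Suc m)) (case_nat \<delta> (case_nat \<gamma> \<alpha>)) v"
  by (subst (1 2 3) wedge_list_swap) (simp add: wedge_list_case_nat_add)

section \<open>Forms of type (p,q)\<close>

lemma forms_subspace: "cfun.subspace (forms j p q)"
  by (simp add: forms_def)

text \<open>The generators of \<open>forms\<close> have their (1,0)-factors in front. Here these may
  stand at any set \<open>S\<close> of positions; moving them to the front costs a sign.\<close>

lemma wedge_list_in_forms: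
  assumes S: "S \<subseteq> {..<m}" "p = card S" "p + q = m"
    and 10: "\<And>i. i \<in> S \<Longrightarrow> \<alpha> i \<in> forms10 j"
    and 01: "\<And>i. i < m \<Longrightarrow> i \<notin> S \<Longrightarrow> \<alpha> i \<in> forms01 j"
  shows "wedge_list m \<alpha> \<in> forms j p q"
proof -
  have fin: "finite S" using S finite_subset by auto
  then have "p = card {..<p}" "finite {..<p}" by auto
  with S fin obtain f where f: "bij_betw f {..<p} S"
    by (metis finite_same_card_bij)
  have "card {p..<m} = card ({..<m} - S)"
    using S fin by (simp add: card_Diff_subset)
  then obtain g where g: "bij_betw g {p..<m} ({..<m} - S)"
    by (metis finite_Diff finite_atLeastLessThan finite_lessThan finite_same_card_bij)
  \<comment> \<open>The first \<open>p\<close> places are sent onto \<open>S\<close> and the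
    remaining ones onto its complement; fixing everything from \<open>m\<close> on makes this a
    permutation in the sense of \<open>permutes\<close>.\<close>
  define \<pi> where "\<pi> i = (if i < p then f i else if i < m then g i else i)" for i
  have "bij_betw \<pi> {..<p} S"
    using f bij_betw_cong[of "{..<p}" \<pi> f S] by (simp add: \<pi>_def)
  moreover have "bij_betw \<pi> {p..<m} ({..<m} - S)"
    using g bij_betw_cong[of "{p..<m}" \<pi> g "{..<m} - S"] by (simp add: \<pi>_def)
  ultimately have "bij_betw \<pi> ({..<p} \<union> {p..<m}) (S \<union> ({..<m} - S))"
    by (rule bij_betw_combine) auto
  moreover have "{..<p} \<union> {p..<m} = {..<m}" "S \<union> ({..<m} - S) = {..<m}"
    using S by auto
  ultimately have bij: "bij_betw \<pi> {..<m} {..<m}" by simp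
  have perm: "\<pi> permutes {..<m}"
    using S by (intro bij_imp_permutes[OF bij]) (auto simp: \<pi>_def)
  have "\<pi> i \<in> S" if "i < p" for i
    using f that by (auto simp: \<pi>_def bij_betw_def)
  moreover have "\<pi> i \<in> {..<m} - S" if "i \<in> {p..<m}" for i
    using g that unfolding bij_betw_def \<pi>_def by auto
  ultimately have "wedge_list m (\<alpha> \<circ> \<pi>) \<in> forms j p q"
    unfolding forms_def using S 10 01 by (intro cfun.span_base) auto
  then have "cscale (of_int (sign \<pi>)) (wedge_list m (\<alpha> \<circ> \<pi>)) \<in> forms j p q"
    by (rule cfun.subspace_scale[OF forms_subspace])
  also have "cscale (of_int (sign \<pi>)) (wedge_list m (\<alpha> \<circ> \<pi>)) = wedge_list m \<alpha>"
    using wedge_list_permute[OF perm, of \<alpha>]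
    by (auto simp: cscale_def fun_eq_iff sign_def)
  finally show ?thesis .
qed

text \<open>The rotation cos t + sin t j acts on (1,0)-forms as \<open>cis t\<close> and on
  (0,1)-forms as its inverse, so type (p,q) is an eigenspace of weight p - q.\<close>

lemma forms_rotate:
  assumes j: "linear j" and \<omega>: "\<omega> \<in> forms j p q"
  shows "\<omega> (\<lambda>l. cos t *\<^sub>R v l + sin t *\<^sub>R j (v l)) = cis (t * (real p - real q)) * \<omega> v"
proof -
  let ?R = "\<lambda>u. cos t *\<^sub>R u + sin t *\<^sub>R j u"
  have 10: "\<alpha> (?R u) = cis t * \<alpha> u" if "\<alpha> \<in> forms10 j" for \<alpha> u
    using that by (auto simp: forms10_def linear_add linear_scale complex_eq_iff)
  have 01: "\<alpha> (?R u) = cis (- t) * \<alpha> u" if "\<alpha> \<in> forms01 j" for \<alpha> u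
    using that by (auto simp: forms01_def linear_add linear_scale complex_eq_iff)
  show ?thesis
    using \<omega> unfolding forms_def
  proof (induction rule: cfun.span_induct)
    case base
    show ?case
      by (auto simp: cfun.subspace_def cscale_def algebra_simps)
  next
    case (step \<omega>)
    then obtain \<alpha> where \<alpha>: "\<omega> = wedge_list (p + q) \<alpha>"
      "\<forall>i<p. \<alpha> i \<in> forms10 j" "\<forall>i\<in>{p..<p + q}. \<alpha> i \<in> forms01 j"
      by auto
    have "(\<Prod>i<p + q. \<alpha> i (?R (v (\<pi> i)))) = cis (t * (real p - real q)) * (\<Prod>i<p + q. \<alpha> i (v (\<pi> i)))" for \<pi>
    proof -
      have "(\<Prod>i<p + q. \<alpha> i (?R (v (\<pi> i)))) =
          (\<Prod>i<p + q. (if i < p then cis t else cis (- t)) * \<alpha> i (v (\<pi> i)))"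
        using \<alpha> by (intro prod.cong) (auto simp: 10 01)
      also have "\<dots> = (\<Prod>i<p + q. if i < p then cis t else cis (- t)) * (\<Prod>i<p + q. \<alpha> i (v (\<pi> i)))"
        by (simp add: prod.distrib)
      also have "(\<Prod>i<p + q. if i < p then cis t else cis (- t)) = cis t ^ p * cis (- t) ^ q"
      proof -
        have "{..<p + q} \<inter> {i. i < p} = {..<p}" "{..<p + q} \<inter> - {i. i < p} = {p..<p + q}"
          by auto
        then show ?thesis by (simp add: prod.If_cases)
      qed
      also have "\<dots> = cis (t * (real p - real q))"
        by (simp add: Complex.DeMoivre cis_mult right_diff_distrib mult.commute)
      finally show ?thesis .
    qed
    then show ?case
      by (simp add: \<alpha>(1) wedge_list_def sum_distrib_left mult_ac)
  qed
qed

text \<open>Averaging over the rotations by multiples of \<open>\<pi> / (p + q + 1)\<close>, weighted by characters,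
  projects onto the forms of type (p,q).\<close>

lemma forms_direct:
  assumes j: "linear j" and \<eta>: "\<eta> \<in> forms j p q"
    and \<eta>': "\<eta> \<in> cfun.span (\<Union>(a, b)\<in>{(a, b). a + b = p + q \<and> (a, b) \<noteq> (p, q)}. forms j a b)"
  shows "\<eta> = 0"
proof
  fix v
  \<comment> \<open>For a + b = p + q the weights a - b and p - q differ by 2 (a - p), so steps of
    \<open>pi / M\<close> produce powers of an \<open>M\<close>-th root of unity. As a and p both
    lie between 0 and p + q, \<open>M = p + q + 1\<close> makes this root different from 1 unless a
    = p, and the sum of its powers vanishes.\<close>
  define M where "M = p + q + 1"
  define t where "t r = pi / M * real r" for r :: nat
  define P where "P \<omega> = (\<Sum>r<M. cis (- t r * (real p - real q)) *
    \<omega> (\<lambda>l. cos (t r) *\<^sub>R v l + sin (t r) *\<^sub>R j (v l)))" for \<omega> :: "'a form"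
  have M: "M > 0" by (simp add: M_def)
  have P: "P \<omega> = (\<Sum>r<M. cis (2 * pi * (real a - real p) / M) ^ r) * \<omega> v"
    if "\<omega> \<in> forms j a b" "a + b = p + q" for \<omega> a b
  proof -
    have 1: "- t r * (real p - real q) + t r * (real a - real b) = real r * (2 * pi * (real a - real p) / M)" for r
    proof -
      have b: "real b = real p + real q - real a" using that(2) by linarith
      have "- t r * (real p - real q) + t r * (real a - real b) = t r * (2 * (real a - real p))"
        unfolding b by (simp add: algebra_simps)
      then show ?thesis by (simp add: t_def)
    qed
    have "P \<omega> = (\<Sum>r<M. cis (- t r * (real p - real q)) * (cis (t r * (real a - real b)) * \<omega> v))"
      by (simp add: P_def forms_rotate[OF j that(1)])
    also have "\<dots> = (\<Sum>r<M. cis (- t r * (real p - real q) + t r * (real a - real b)) * \<omega> v)"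
      by (simp only: cis_mult[symmetric] mult.assoc)
    also have "\<dots> = (\<Sum>r<M. cis (2 * pi * (real a - real p) / M) ^ r) * \<omega> v"
      unfolding 1 by (simp only: Complex.DeMoivre sum_distrib_right)
    finally show ?thesis .
  qed
  have P0: "P \<omega> = 0" if ab: "\<omega> \<in> forms j a b" "a + b = p + q" "(a, b) \<noteq> (p, q)" for \<omega> a b
  proof -
    let ?z = "cis (2 * pi * (real a - real p) / M)"
    have "?z \<noteq> 1"
    proof
      assume "?z = 1"
      then have "cos (2 * pi * (real a - real p) / M) = 1"
        by (metis cis.simps(1) one_complex.simps(1))
      then obtain i :: int where i: "2 * pi * (real a - real p) / M = of_int i * 2 * pi"
        using cos_one_2pi_int by blast
      then have "pi * (real a - real p) = pi * (i * real M)"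
        using M by (simp add: field_simps)
      then have "real a - real p = of_int i * real M"
        by simp
      then have ii: "int a - int p = i * int M"
        by (metis of_int_diff of_int_eq_iff of_int_mult of_int_of_nat_eq)
      have "\<bar>int a - int p\<bar> < int M" "int a \<noteq> int p"
        using ab by (auto simp: M_def)
      then show False
        using ii M mult_left_mono[of 1 "\<bar>i\<bar>" "int M"] by (cases "i = 0") (simp_all add: abs_mult)
    qed
    moreover have "?z ^ M = 1"
    proof -
      have "?z ^ M = cis (2 * pi * (real_of_int (int a - int p)))"
        using M by (simp add: Complex.DeMoivre)
      also have "\<dots> = 1" by (rule cis_multiple_2pi) simp
      finally show ?thesis .
    qed
    ultimately have "(\<Sum>r<M. ?z ^ r) = 0"
      by (simp add: sum_gp_strict)
    then show ?thesis using P[OF ab(1,2)] by simp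
  qed
  have "P \<eta> = 0"
    using \<eta>'
  proof (induction rule: cfun.span_induct)
    case base
    show ?case
      by (auto simp: cfun.subspace_def P_def cscale_def algebra_simps sum.distrib simp flip: sum_distrib_left)
  qed (auto intro: P0)
  moreover have "P \<eta> = of_nat M * \<eta> v"
    using P[OF \<eta>] by simp
  ultimately show "\<eta> v = 0 v" using M by simp
qed

text \<open>Directness of the type decomposition makes the description in \<open>type_part\<close>
  unique; a component is then computed by exhibiting it together with a remainder of the other
  types.\<close>

lemma type_part_eq:
  assumes "linear j" and "\<eta> \<in> forms j p q"
    and "\<omega> - \<eta> \<in> cfun.span (\<Union>(a, b)\<in>{(a, b). a + b = p + q \<and> (a, b) \<noteq> (p, q)}. forms j a b)"
  shows "type_part j p q \<omega> = \<eta>"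
  unfolding type_part_def
proof (rule the_equality)
  fix \<eta>' assume \<eta>': "\<eta>' \<in> forms j p q \<and>
    \<omega> - \<eta>' \<in> cfun.span (\<Union>(a, b)\<in>{(a, b). a + b = p + q \<and> (a, b) \<noteq> (p, q)}. forms j a b)"
  have "\<eta>' - \<eta> \<in> forms j p q"
    using \<eta>' assms cfun.subspace_diff[OF forms_subspace] by blast
  moreover have "(\<omega> - \<eta>) - (\<omega> - \<eta>') \<in>
      cfun.span (\<Union>(a, b)\<in>{(a, b). a + b = p + q \<and> (a, b) \<noteq> (p, q)}. forms j a b)"
    using cfun.span_diff[OF assms(3)] \<eta>' by blast
  ultimately have "\<eta>' - \<eta> = 0"
    by (intro forms_direct[OF assms(1)]) simp_all
  then show "\<eta>' = \<eta>" by simp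
qed (use assms in auto)

section \<open>Smooth maps\<close>

text \<open>The recursion for \<open>Ck\<close> constrains derivatives only, so the inclusion is
  proved by induction down to continuity. The product rule requires it, because each term keeps an
  undifferentiated factor.\<close>

lemma Ck_Suc_imp_Ck: "Ck (Suc k) f \<Longrightarrow> Ck k f"
proof (induction k arbitrary: f)
  case 0
  then have "continuous_on UNIV f"
    by (simp add: continuous_at_imp_continuous_on differentiable_imp_continuous_within)
  then show ?case by simp
next
  case (Suc k)
  then show ?case by (metis Ck.simps(2))
qed

lemma Ck_const: "Ck k (\<lambda>p. c)"
  by (induction k arbitrary: c) auto

lemma Ck_bounded_linear:
  assumes "bounded_linear L"
  shows "Ck k L"
proof (cases k)
  case 0
  then show ?thesis using linear_continuous_on[OF assms] by simp
next
  case (Suc m)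
  have "(L has_derivative L) (at p)" for p
    using assms by (rule bounded_linear_imp_has_derivative)
  then have "L differentiable (at p)" "frechet_derivative L (at p) = L" for p
    by (auto simp: differentiable_def frechet_derivative_at[symmetric])
  then show ?thesis using Suc by (simp add: Ck_const)
qed

lemma Ck_compose_bounded_linear:
  assumes L: "bounded_linear L"
  shows "Ck k f \<Longrightarrow> Ck k (\<lambda>p. L (f p))"
proof (induction k arbitrary: f)
  case 0
  then show ?case using bounded_linear.continuous_on[OF L] by simp
next
  case (Suc k)
  have D: "((\<lambda>p. L (f p)) has_derivative (\<lambda>v. L (frechet_derivative f (at p) v))) (at p)" for p
    using Suc.prems by (auto intro!: bounded_linear.has_derivative[OF L] simp flip: frechet_derivative_works)
  have "(\<lambda>p. L (f p)) differentiable (at p)" for p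
    using D by (auto simp: differentiable_def)
  moreover have "frechet_derivative (\<lambda>p. L (f p)) (at p) v = L (frechet_derivative f (at p) v)" for p v
    by (simp add: frechet_derivative_at[OF D, symmetric])
  ultimately show ?case using Suc by simp
qed

lemma Ck_add: "Ck k f \<Longrightarrow> Ck k g \<Longrightarrow> Ck k (\<lambda>p. f p + g p)"
proof (induction k arbitrary: f g)
  case 0
  then show ?case by (auto intro: continuous_intros)
next
  case (Suc k)
  have D: "((\<lambda>p. f p + g p) has_derivative
      (\<lambda>v. frechet_derivative f (at p) v + frechet_derivative g (at p) v)) (at p)" for p
    using Suc.prems by (auto intro!: has_derivative_add simp flip: frechet_derivative_works)
  have "(\<lambda>p. f p + g p) differentiable (at p)" for p
    using D by (auto simp: differentiable_def)
  moreover have "frechet_derivative (\<lambda>p. f p + g p) (at p) v =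
      frechet_derivative f (at p) v + frechet_derivative g (at p) v" for p v
    by (simp add: frechet_derivative_at[OF D, symmetric])
  ultimately show ?case using Suc by simp
qed

lemma Ck_mult:
  fixes f g :: "'a::euclidean_space \<Rightarrow> 'b::real_normed_algebra"
  shows "Ck k f \<Longrightarrow> Ck k g \<Longrightarrow> Ck k (\<lambda>p. f p * g p)"
proof (induction k arbitrary: f g)
  case 0
  then show ?case by (auto intro: continuous_intros)
next
  case (Suc k)
  have D: "((\<lambda>p. f p * g p) has_derivative
      (\<lambda>v. f p * frechet_derivative g (at p) v + frechet_derivative f (at p) v * g p)) (at p)" for p
    using Suc.prems by (auto intro!: has_derivative_mult simp flip: frechet_derivative_works)
  have "(\<lambda>p. f p * g p) differentiable (at p)" for p
    using D by (auto simp: differentiable_def)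
  moreover have "frechet_derivative (\<lambda>p. f p * g p) (at p) v =
      f p * frechet_derivative g (at p) v + frechet_derivative f (at p) v * g p" for p v
    by (simp add: frechet_derivative_at[OF D, symmetric])
  moreover have "Ck k f" "Ck k g"
    using Suc.prems Ck_Suc_imp_Ck by blast+
  ultimately show ?case using Suc by (simp add: Ck_add)
qed

lemma smooth_map_const [intro, simp]: "smooth_map (\<lambda>p. c)"
  by (simp add: smooth_map_def Ck_const)

lemma smooth_map_bounded_linear: "bounded_linear L \<Longrightarrow> smooth_map L"
  by (simp add: smooth_map_def Ck_bounded_linear)

lemma smooth_map_compose_bounded_linear:
  "bounded_linear L \<Longrightarrow> smooth_map f \<Longrightarrow> smooth_map (\<lambda>p. L (f p))"
  by (simp add: smooth_map_def Ck_compose_bounded_linear)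

lemma smooth_map_add: "smooth_map f \<Longrightarrow> smooth_map g \<Longrightarrow> smooth_map (\<lambda>p. f p + g p)"
  by (simp add: smooth_map_def Ck_add)

lemma smooth_map_mult:
  fixes f g :: "'a::euclidean_space \<Rightarrow> 'b::real_normed_algebra"
  shows "smooth_map f \<Longrightarrow> smooth_map g \<Longrightarrow> smooth_map (\<lambda>p. f p * g p)"
  by (simp add: smooth_map_def Ck_mult)

lemma smooth_map_sum: "(\<And>i. i \<in> I \<Longrightarrow> smooth_map (f i)) \<Longrightarrow> smooth_map (\<lambda>p. \<Sum>i\<in>I. f i p)"
  by (induction I rule: infinite_finite_induct) (auto intro: smooth_map_add)

lemma smooth_map_prod:
  fixes f :: "'i \<Rightarrow> 'a::euclidean_space \<Rightarrow> 'b::{real_normed_algebra,comm_ring_1}"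
  shows "(\<And>i. i \<in> I \<Longrightarrow> smooth_map (f i)) \<Longrightarrow> smooth_map (\<lambda>p. \<Prod>i\<in>I. f i p)"
  by (induction I rule: infinite_finite_induct) (auto intro: smooth_map_mult)

lemma smooth_map_differentiable: "smooth_map f \<Longrightarrow> f differentiable (at p)"
  by (metis Ck.simps(2) smooth_map_def)

lemma smooth_map_has_derivative: "smooth_map f \<Longrightarrow> (f has_derivative frechet_derivative f (at p)) (at p)"
  using smooth_map_differentiable frechet_derivative_works by blast

lemma smooth_map_frechet_derivative: "smooth_map f \<Longrightarrow> smooth_map (\<lambda>p. frechet_derivative f (at p) v)"
  unfolding smooth_map_def by (metis Ck.simps(2))

lemma smooth_map_continuous_on: "smooth_map f \<Longrightarrow> continuous_on S f"
  unfolding smooth_map_def using Ck.simps(1) continuous_on_subset by blast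

text \<open>\<open>Ck\<close> speaks of constant directions; a variable direction is expanded in
  \<open>Basis\<close>. This is applied to the direction \<open>J p u\<close>.\<close>

lemma smooth_map_frechet_derivative_along:
  fixes f :: "'a::euclidean_space \<Rightarrow> complex" and X :: "'a \<Rightarrow> 'a"
  assumes f: "smooth_map f" and X: "smooth_map X"
  shows "smooth_map (\<lambda>p. frechet_derivative f (at p) (X p))"
proof -
  have "frechet_derivative f (at p) (X p) =
      (\<Sum>b\<in>Basis. complex_of_real (X p \<bullet> b) * frechet_derivative f (at p) b)" for p
  proof -
    have L: "linear (frechet_derivative f (at p))"
      using f by (intro linear_frechet_derivative smooth_map_differentiable)
    have "frechet_derivative f (at p) (X p) = frechet_derivative f (at p) (\<Sum>b\<in>Basis. (X p \<bullet> b) *\<^sub>R b)"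
      by (simp add: euclidean_representation)
    also have "\<dots> = (\<Sum>b\<in>Basis. complex_of_real (X p \<bullet> b) * frechet_derivative f (at p) b)"
      by (simp add: linear_sum[OF L] linear_scale[OF L] scaleR_conv_of_real)
    finally show ?thesis .
  qed
  moreover have "bounded_linear (\<lambda>v. complex_of_real (v \<bullet> b))" for b :: 'a
    by (intro bounded_linear_compose[OF bounded_linear_of_real] bounded_linear_inner_left)
  ultimately show ?thesis
    using f X by (auto intro!: smooth_map_sum smooth_map_mult smooth_map_frechet_derivative
        smooth_map_compose_bounded_linear[where f = X])
qed

section \<open>Bounded solutions of the twisted Cauchy-Riemann equation\<close>

text \<open>The equation makes the real derivative at \<open>w\<close> multiplication by the complex
  number \<open>a w\<close>, so \<open>f\<close> is entire and Liouville applies.\<close>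

lemma bounded_cauchy_riemann_constant:
  fixes f :: "complex \<Rightarrow> complex"
  assumes D: "\<And>w. (f has_derivative (\<lambda>h. Re h *\<^sub>R a w + Im h *\<^sub>R b w)) (at w)"
    and CR: "\<And>w. a w + \<i> * b w = 0" and bdd: "bounded (range f)"
  shows "f w = f 0"
proof -
  have "a w = - (\<i> * b w)" for w
    using CR by (rule eq_neg_iff_add_eq_0[THEN iffD2])
  moreover have "Re h *\<^sub>R - (\<i> * z) + Im h *\<^sub>R z = - (\<i> * z) * h" for h z
    by (simp add: complex_eq_iff)
  ultimately have "Re h *\<^sub>R a w + Im h *\<^sub>R b w = a w * h" for h w
    by simp
  then have "(\<lambda>h. Re h *\<^sub>R a w + Im h *\<^sub>R b w) = (*) (a w)" for w
    by (rule ext)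
  then have "(f has_derivative (*) (a w)) (at w)" for w
    using D[of w] by (simp only:)
  then have "f field_differentiable (at w)" for w
    unfolding field_differentiable_def has_field_derivative_def by blast
  then have "f holomorphic_on UNIV"
    by (simp add: holomorphic_on_def field_differentiable_at_within)
  then have "f constant_on UNIV"
    using bdd by (rule Liouville_theorem)
  then show ?thesis by (auto simp: constant_on_def)
qed

text \<open>The character \<open>exp ((c w\<^sup>* - c\<^sup>* w) / 2)\<close> is unitary, so dividing by it keeps the solution bounded
  and makes it holomorphic.\<close>

lemma bounded_twisted_cauchy_riemann:
  fixes f :: "complex \<Rightarrow> complex"
  assumes D: "\<And>w. (f has_derivative (\<lambda>h. Re h *\<^sub>R a w + Im h *\<^sub>R b w)) (at w)"
    and CR: "\<And>w. a w + \<i> * b w = c * f w" and bdd: "bounded (range f)"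
  shows "f w = f 0 * exp ((c * cnj w - cnj c * w) / 2)"
proof -
  define \<mu> where "\<mu> w = exp (- ((c * cnj w - cnj c * w) / 2))" for w
  have "bounded_linear (\<lambda>z. - ((c * cnj z - cnj c * z) / 2))"
    unfolding divide_inverse
    by (intro bounded_linear_minus bounded_linear_mult_const bounded_linear_sub bounded_linear_const_mult
        bounded_linear_cnj bounded_linear_ident)
  then have L: "((\<lambda>z. - ((c * cnj z - cnj c * z) / 2)) has_derivative (\<lambda>z. - ((c * cnj z - cnj c * z) / 2))) (at w)" for w
    by (rule bounded_linear_imp_has_derivative)
  have D\<mu>: "(\<mu> has_derivative (\<lambda>h. \<mu> w * - ((c * cnj h - cnj c * h) / 2))) (at w)" for w
    unfolding \<mu>_def[abs_def]
    by (rule has_derivative_compose[OF L DERIV_exp[unfolded has_field_derivative_def]])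
  have norm\<mu>: "norm (\<mu> w) = 1" for w
    by (simp add: \<mu>_def norm_exp_eq_Re)
  \<comment> \<open>\<open>A\<close> and \<open>B\<close> are the derivatives of the product
    \<open>f w * \<mu> w\<close> in the directions 1 and \<i>, obtained by putting h = 1 and h =
    \<i> into the exponent of \<mu>.\<close>
  define A where "A w = a w * \<mu> w + f w * (\<mu> w * - ((c - cnj c) / 2))" for w
  define B where "B w = b w * \<mu> w + f w * (\<mu> w * (\<i> * (c + cnj c) / 2))" for w
  have "((\<lambda>w. f w * \<mu> w) has_derivative (\<lambda>h. Re h *\<^sub>R A w + Im h *\<^sub>R B w)) (at w)" for w
  proof (rule has_derivative_eq_rhs[OF has_derivative_mult[OF D D\<mu>]], rule ext)
    fix h :: complex
    have E: "- ((c * cnj h - cnj c * h) / 2) =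
        complex_of_real (Re h) * - ((c - cnj c) / 2) + complex_of_real (Im h) * (\<i> * (c + cnj c) / 2)"
      by (simp add: complex_eq_iff diff_divide_distrib)
    have "y * (m * (s * X + t * Y)) + (s * a' + t * b') * m = s * (a' * m + y * (m * X)) + t * (b' * m + y * (m * Y))"
      for y m s t X Y a' b' :: complex
      by (simp add: algebra_simps)
    then show "f w * (\<mu> w * - ((c * cnj h - cnj c * h) / 2)) + (Re h *\<^sub>R a w + Im h *\<^sub>R b w) * \<mu> w =
        Re h *\<^sub>R A w + Im h *\<^sub>R B w"
      unfolding A_def B_def scaleR_conv_of_real E by blast
  qed
  moreover have "A w + \<i> * B w = 0" for w
  proof -
    have "A w + \<i> * B w = (a w + \<i> * b w) * \<mu> w - ((c - cnj c) / 2 + (c + cnj c) / 2) * f w * \<mu> w"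
      unfolding A_def B_def times_divide_eq_right[symmetric] by (simp only: algebra_simps) simp
    \<comment> \<open>The two directional derivatives of the exponent combine to exactly the twist
      \<open>c\<close>, which cancels the right-hand side of the equation.\<close>
    also have "(c - cnj c) / 2 + (c + cnj c) / 2 = c"
      by (simp flip: add_divide_distrib)
    finally have "A w + \<i> * B w = (a w + \<i> * b w) * \<mu> w - c * f w * \<mu> w" .
    then show ?thesis by (simp only: CR) simp
  qed
  moreover have "bounded (range (\<lambda>w. f w * \<mu> w))"
    using bdd by (auto simp: bounded_iff norm_mult norm\<mu>)
  ultimately have eq: "f w * \<mu> w = f 0 * \<mu> 0"
    by (rule bounded_cauchy_riemann_constant[where f = "\<lambda>w. f w * \<mu> w" and a = A and b = B])
  have "\<mu> w * exp ((c * cnj w - cnj c * w) / 2) = 1"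
    unfolding \<mu>_def exp_add[symmetric] by simp
  then have "f w = f w * \<mu> w * exp ((c * cnj w - cnj c * w) / 2)"
    by (simp only: mult.assoc mult_1_right)
  also have "f w * \<mu> w = f 0"
    unfolding eq by (simp add: \<mu>_def)
  finally show ?thesis .
qed

section \<open>A basis adapted to a complex structure\<close>

text \<open>Regard the space as a complex vector space on which \<i> acts as \<open>j\<close>,
  extend \<open>a\<close> to a complex basis and take the coordinate functions. Choosing
  \<open>a\<close> first serves to put the central direction at index 0.\<close>

lemma complex_structure_basis:
  fixes j :: "'v::euclidean_space \<Rightarrow> 'v" and a :: 'v
  assumes j: "linear j" and jj: "\<And>v. j (j v) = - v" and a: "a \<noteq> 0"
  defines "k \<equiv> DIM('v) div 2"
  obtains e \<alpha> where "e 0 = a"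
    "\<And>i. i < k \<Longrightarrow> \<alpha> i \<in> forms10 j"
    "\<And>i l. i < k \<Longrightarrow> l < k \<Longrightarrow> \<alpha> i (e l) = (if i = l then 1 else 0)"
    "\<And>\<beta> v. \<beta> \<in> forms10 j \<Longrightarrow> \<beta> v = (\<Sum>i<k. \<beta> (e i) * \<alpha> i v)"
proof -
  define sc where "sc c v = Re c *\<^sub>R v + Im c *\<^sub>R j v" for c v
  interpret C: vector_space sc
    by unfold_locales (auto simp: sc_def linear_add[OF j] linear_scale[OF j] jj algebra_simps)
  have sc_of_real: "sc (of_real r) v = r *\<^sub>R v" and sc_i: "sc \<i> v = j v" for r v
    by (simp_all add: sc_def)
  define B where "B = C.extend_basis {a}"
  have ind_a: "C.independent {a}" using a by simp
  then have B: "a \<in> B" "C.independent B" "C.span B = UNIV"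
    using C.extend_basis_superset[OF ind_a] C.independent_extend_basis[OF ind_a]
      C.span_extend_basis[OF ind_a] by (auto simp: B_def)
  have "independent B"
    unfolding real_vector.independent_explicit_finite_subsets
  proof (intro allI impI ballI)
    fix S u v assume S: "S \<subseteq> B" "finite S" "(\<Sum>v\<in>S. u v *\<^sub>R v) = 0" "v \<in> S"
    then have "(\<Sum>v\<in>S. sc (of_real (u v)) v) = 0" by (simp add: sc_of_real)
    then have "complex_of_real (u v) = 0"
      by (rule C.independentD[OF B(2) S(2) S(1) _ S(4)])
    then show "u v = 0" by simp
  qed
  then have fin: "finite B"
    using independent_imp_finite by blast
  have inj: "inj_on j B"
    by (rule inj_on_inverseI[where g = "\<lambda>v. - j v"]) (simp add: jj)
  have disj: "B \<inter> j ` B = {}"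
  proof (rule ccontr)
    assume "B \<inter> j ` B \<noteq> {}"
    then obtain b where b: "b \<in> B" "j b \<in> B" by auto
    show False
    proof (cases "j b = b")
      case True
      then have "b = - b" by (metis jj)
      then have "2 *\<^sub>R b = 0" by (simp add: scaleR_2 eq_neg_iff_add_eq_0)
      then have "b = 0" by simp
      then show False using B(2) b C.dependent_zero by blast
    next
      case False
      \<comment> \<open>Over the complex numbers \<open>j b\<close> is \<i> times \<open>b\<close>,
        so both cannot belong to \<open>B\<close>.\<close>
      then have "(\<Sum>v\<in>{b, j b}. sc (if v = b then \<i> else - 1) v) = 0"
        by (auto simp: sc_i sc_def)
      then have "(if b = b then \<i> else - 1) = 0"
        using C.independentD[OF B(2), of "{b, j b}" "\<lambda>v. if v = b then \<i> else - 1" b] b by blast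
      then show False by simp
    qed
  qed
  have sum_D: "(\<Sum>x\<in>B \<union> j ` B. u x *\<^sub>R x) = (\<Sum>b\<in>B. sc (Complex (u b) (u (j b))) b)" for u
    using fin disj inj by (simp add: sum.union_disjoint sum.reindex sc_def sum.distrib)
  have ind_D: "independent (B \<union> j ` B)"
    unfolding independent_explicit
  proof (intro conjI allI impI ballI)
    fix u v assume u: "(\<Sum>v\<in>B \<union> j ` B. u v *\<^sub>R v) = 0" and v: "v \<in> B \<union> j ` B"
    have "Complex (u b) (u (j b)) = 0" if "b \<in> B" for b
      using C.independentD[OF B(2) fin subset_refl, of "\<lambda>b. Complex (u b) (u (j b))"] u that
      by (simp add: sum_D)
    then show "u v = 0" using v by (auto simp: complex_eq_iff)
  qed (use fin in simp)
  have span_D: "span (B \<union> j ` B) = UNIV"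
  proof -
    have "v \<in> span (B \<union> j ` B)" for v
    proof -
      obtain u where "v = (\<Sum>b\<in>B. sc (u b) b)"
        using B(3) C.span_finite[OF fin] by blast
      then show ?thesis
        by (auto simp: sc_def intro!: span_sum span_add span_scale intro: span_base)
    qed
    then show ?thesis by auto
  qed
  \<comment> \<open>\<open>B\<close> and its image under \<open>j\<close> form a real basis, so the
    complex basis has half the real dimension.\<close>
  have "card (B \<union> j ` B) = 2 * card B"
    using fin disj by (simp add: card_Un_disjoint card_image[OF inj])
  then have dim: "DIM('v) = 2 * card B"
    using dim_eq_card[OF _ ind_D, of UNIV] span_D by simp
  then have k: "card B = k" by (simp add: k_def)
  obtain h where h: "bij_betw h {0..<k} B"
    using ex_bij_betw_nat_finite[OF fin] k by auto
  then obtain i where i: "i < k" "h i = a"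
    using B(1) by (auto simp: bij_betw_def)
  \<comment> \<open>The transposition moves the index of \<open>a\<close> in the enumeration
    \<open>h\<close> to 0.\<close>
  define e where "e = h \<circ> Transposition.transpose 0 i"
  have "Transposition.transpose 0 i permutes {0..<k}"
    using i by (intro permutes_swap_id) auto
  then have e: "bij_betw e {..<k} B"
    unfolding e_def using h bij_betw_trans permutes_imp_bij by (metis atLeast0LessThan)
  have e0: "e 0 = a" using i by (simp add: e_def)
  have eB: "e l \<in> B" if "l < k" for l
    using e that by (auto simp: bij_betw_def)
  define \<alpha> where "\<alpha> i v = C.representation B v (e i)" for i v
  have "linear (\<alpha> i)" for i
  proof
    fix x y :: 'v and r :: real
    show "\<alpha> i (x + y) = \<alpha> i x + \<alpha> i y"
      using B by (simp add: \<alpha>_def C.representation_add)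
    have "\<alpha> i (sc (of_real r) x) = r * \<alpha> i x"
      using B by (simp add: \<alpha>_def C.representation_scale)
    then show "\<alpha> i (r *\<^sub>R x) = r *\<^sub>R \<alpha> i x"
      by (simp add: sc_of_real scaleR_conv_of_real)
  qed
  moreover have "\<alpha> i (j v) = \<i> * \<alpha> i v" for i v
    using B by (simp add: \<alpha>_def C.representation_scale flip: sc_i)
  ultimately have "\<alpha> i \<in> forms10 j" for i
    by (auto simp: forms10_def)
  moreover have "\<alpha> i (e l) = (if i = l then 1 else 0)" if "i < k" "l < k" for i l
    using B(2) e that eB by (auto simp: \<alpha>_def C.representation_basis bij_betw_def inj_on_def)
  moreover have "\<beta> v = (\<Sum>i<k. \<beta> (e i) * \<alpha> i v)" if "\<beta> \<in> forms10 j" for \<beta> v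
  proof -
    have \<beta>: "linear \<beta>" "\<And>v. \<beta> (j v) = \<i> * \<beta> v"
      using that by (auto simp: forms10_def)
    have \<beta>sc: "\<beta> (sc c v) = c * \<beta> v" for c v
      by (simp add: sc_def linear_add[OF \<beta>(1)] linear_scale[OF \<beta>(1)] \<beta>(2) scaleR_conv_of_real
          complex_eq_iff)
    have "\<beta> v = \<beta> (\<Sum>b\<in>B. sc (C.representation B v b) b)"
      using B by (simp add: C.sum_representation_eq[OF B(2) _ fin subset_refl])
    also have "\<dots> = (\<Sum>b\<in>B. C.representation B v b * \<beta> b)"
      by (simp add: linear_sum[OF \<beta>(1)] \<beta>sc)
    also have "\<dots> = (\<Sum>i<k. C.representation B v (e i) * \<beta> (e i))"
      using sum.reindex_bij_betw[OF e] by (metis (mono_tags, lifting) sum.cong)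
    finally show ?thesis by (simp add: \<alpha>_def mult.commute)
  qed
  ultimately show ?thesis
    using that[of e \<alpha>] e0 by simp
qed

section \<open>The left-invariant frame\<close>

text \<open>The central vector d/dz, tangent to the fibres of the projection that forgets z.\<close>

definition fibre :: "'n::finite kt"
  where "fibre = (0, 0, 1, 0)"

text \<open>The value at \<open>p\<close> of the left-invariant field with value \<open>v\<close> at
  the origin, equivalently the differential of left translation by \<open>p\<close>. Only the x-part
  of \<open>p\<close> enters, so \<open>frame (- p)\<close> is its inverse although
  \<open>- p\<close> is not in general the inverse of \<open>p\<close> in the group.\<close>

definition frame :: "'n::finite kt \<Rightarrow> 'n kt \<Rightarrow> 'n kt"
  where "frame p v = v + inner (fst p) (fst (snd v)) *\<^sub>R fibre"

lemma fst_frame [simp]: "fst (frame p v) = fst v" "fst (snd (frame p v)) = fst (snd v)"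
  by (simp_all add: frame_def fibre_def)

lemma linear_frame: "linear (frame p)"
  by (rule linearI) (simp_all add: frame_def algebra_simps)

lemma frame_0 [simp]: "frame 0 v = v"
  by (simp add: frame_def)

lemma frame_minus_frame [simp]: "frame (- p) (frame p v) = v" "frame p (frame (- p) v) = v"
  by (simp_all add: frame_def fibre_def zero_prod_def)

lemma frame_fibre [simp]: "frame p fibre = fibre"
  by (simp add: frame_def fibre_def)

lemma frame_kt_mult: "frame (kt_mult g p) v = frame g (frame p v)"
  by (cases g; cases p) (simp add: frame_def fibre_def inner_add_left algebra_simps)

lemma frame_minus_kt_mult [simp]: "frame (- kt_mult g p) (frame g v) = frame (- p) v"
proof -
  have "frame g v = frame (kt_mult g p) (frame (- p) v)"
    by (simp add: frame_kt_mult)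
  then show ?thesis by simp
qed

lemma frechet_derivative_kt_mult_frame [simp]: "frechet_derivative (kt_mult g) (at p) = frame g"
proof
  fix v show "frechet_derivative (kt_mult g) (at p) v = frame g v"
    by (cases g; cases v) (simp add: frechet_derivative_kt_mult frame_def fibre_def)
qed

lemma has_derivative_kt_mult: "(kt_mult g has_derivative frame g) (at p)"
proof -
  obtain x y z t where g: "g = (x, y, z, t)" by (metis surj_pair)
  have "kt_mult g = (\<lambda>q. g + frame g q)"
    by (auto simp: g fun_eq_iff frame_def fibre_def)
  moreover have "bounded_linear (frame g)"
    using linear_frame linear_conv_bounded_linear by blast
  ultimately show ?thesis
    by (auto intro!: derivative_eq_intros bounded_linear_imp_has_derivative)
qed

lemma frechet_derivative_invariant:
  assumes f: "smooth_fun KT f" and g: "g \<in> kt_lattice"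
  shows "frechet_derivative f (at (kt_mult g p)) (frame g v) = frechet_derivative f (at p) v"
proof -
  have "smooth_map f" and inv: "f \<circ> kt_mult g = f"
    using f g by (auto simp: smooth_fun_def KT_def)
  then have "(f \<circ> kt_mult g has_derivative frechet_derivative f (at (kt_mult g p)) \<circ> frame g) (at p)"
    by (intro diff_chain_at has_derivative_kt_mult smooth_map_has_derivative)
  then show ?thesis
    unfolding inv by (metis comp_apply frechet_derivative_at)
qed

declare split_paired_All [simp del] split_paired_Ex [simp del]

section \<open>Compactness of the quotient\<close>

lemma lattice_translate_into_cube:
  obtains g where "g \<in> kt_lattice" "kt_mult g p \<in> cbox (0, 0, 0, 0) (1, 1, 1, 1)"
proof -
  obtain x y z t where p: "p = (x, y, z, t)" by (metis surj_pair)
  define a where "a = vec_lambda (\<lambda>i. - real_of_int \<lfloor>vec_nth x i\<rfloor>)"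
  define b where "b = vec_lambda (\<lambda>i. - real_of_int \<lfloor>vec_nth y i\<rfloor>)"
  \<comment> \<open>Translation by \<open>(a, b, c, d)\<close> also adds \<open>inner a y\<close> to
    z, so the integer part is removed after this shift.\<close>
  define c where "c = - real_of_int \<lfloor>z + inner a y\<rfloor>"
  define d where "d = - real_of_int \<lfloor>t\<rfloor>"
  have fl: "0 \<le> - real_of_int \<lfloor>r\<rfloor> + r" "- real_of_int \<lfloor>r\<rfloor> + r \<le> 1" for r
    using floor_correct[of r] by linarith+
  have "(a, b, c, d) \<in> kt_lattice"
    by (simp add: kt_lattice_def a_def b_def c_def d_def)
  moreover have "kt_mult (a, b, c, d) p \<in> cbox (0, 0, 0, 0) (1, 1, 1, 1)"
  proof -
    have "0 \<le> c + z + inner a y" "c + z + inner a y \<le> 1" "0 \<le> d + t" "d + t \<le> 1"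
      using fl[of "z + inner a y"] fl[of t] unfolding c_def d_def by linarith+
    moreover have "0 \<le> vec_nth a i + vec_nth x i" "vec_nth a i + vec_nth x i \<le> 1"
      "0 \<le> vec_nth b i + vec_nth y i" "vec_nth b i + vec_nth y i \<le> 1" for i
      using fl by (simp_all add: a_def b_def)
    ultimately show ?thesis
      by (simp add: p cbox_Pair_eq mem_box_cart)
  qed
  ultimately show ?thesis using that by blast
qed

text \<open>Every value is already attained on a compact cube that meets all orbits of the lattice.
  This supplies the boundedness for Liouville.\<close>

lemma bounded_smooth_fun:
  assumes "smooth_fun KT f"
  shows "bounded (range f)"
proof -
  have sf: "smooth_map f" and inv: "g \<in> kt_lattice \<Longrightarrow> f (kt_mult g p) = f p" for g p
    using assms by (auto simp: smooth_fun_def KT_def)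
  have "compact (f ` cbox (0, 0, 0, 0) (1, 1, 1, 1))"
    by (intro compact_continuous_image smooth_map_continuous_on sf compact_cbox)
  then have "bounded (f ` cbox (0, 0, 0, 0) (1, 1, 1, 1))"
    by (rule compact_imp_bounded)
  moreover have "f p \<in> f ` cbox (0, 0, 0, 0) (1, 1, 1, 1)" for p
  proof -
    obtain g where g: "g \<in> kt_lattice" "kt_mult g p \<in> cbox (0, 0, 0, 0) (1, 1, 1, 1)"
      by (rule lattice_translate_into_cube)
    show ?thesis by (rule image_eqI[where f = f and x = "kt_mult g p", OF inv[OF g(1), symmetric] g(2)])
  qed
  then have "range f \<subseteq> f ` cbox (0, 0, 0, 0) (1, 1, 1, 1)"
    by (rule image_subsetI)
  ultimately show ?thesis
    by (rule bounded_subset)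
qed

lemma DIM_kt: "DIM('n::finite kt) div 2 = Suc CARD('n)"
  by simp

section \<open>Types of 1-forms\<close>

definition part10 :: "('v \<Rightarrow> 'v) \<Rightarrow> ('v \<Rightarrow> complex) \<Rightarrow> 'v \<Rightarrow> complex"
  where "part10 j \<beta> v = (\<beta> v - \<i> * \<beta> (j v)) / 2"

definition part01 :: "('v \<Rightarrow> 'v) \<Rightarrow> ('v \<Rightarrow> complex) \<Rightarrow> 'v \<Rightarrow> complex"
  where "part01 j \<beta> v = (\<beta> v + \<i> * \<beta> (j v)) / 2"

lemma part10_add_part01: "part10 j \<beta> v + part01 j \<beta> v = \<beta> v"
  by (simp add: part10_def part01_def field_simps)

lemma
  assumes "linear j" "\<And>v. j (j v) = - v" "linear \<beta>"
  shows part10_in_forms10: "part10 j \<beta> \<in> forms10 j" and part01_in_forms01: "part01 j \<beta> \<in> forms01 j"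
proof -
  have "linear (part10 j \<beta>)" "linear (part01 j \<beta>)"
    using assms(1,3)
    by (auto intro!: linearI simp: part10_def part01_def linear_add linear_scale scaleR_conv_of_real field_simps)
  moreover have "part10 j \<beta> (j v) = \<i> * part10 j \<beta> v" "part01 j \<beta> (j v) = - \<i> * part01 j \<beta> v" for v
    using assms(2,3) by (simp_all add: part10_def part01_def linear_neg field_simps)
  ultimately show "part10 j \<beta> \<in> forms10 j" "part01 j \<beta> \<in> forms01 j"
    by (auto simp: forms10_def forms01_def)
qed

lemma forms01_zero: "(\<lambda>u. 0) \<in> forms01 j"
  by (auto simp: forms01_def intro: linearI)

lemma forms01_add: "\<theta> \<in> forms01 j \<Longrightarrow> \<theta>' \<in> forms01 j \<Longrightarrow> (\<lambda>u. \<theta> u + \<theta>' u) \<in> forms01 j"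
  by (auto simp: forms01_def linear_compose_add algebra_simps)

lemma forms01_scale: "\<theta> \<in> forms01 j \<Longrightarrow> (\<lambda>u. c * \<theta> u) \<in> forms01 j"
  by (auto simp: forms01_def intro!: linearI simp: linear_add linear_scale algebra_simps)

lemma forms01_sum: "(\<And>i. i \<in> I \<Longrightarrow> \<theta> i \<in> forms01 j) \<Longrightarrow> (\<lambda>u. \<Sum>i\<in>I. \<theta> i u) \<in> forms01 j"
  by (induction I rule: infinite_finite_induct) (auto intro: forms01_zero forms01_add)

text \<open>In degree 1 the only other type is (1,0), so the remainder to be exhibited is
  \<open>part10\<close> of the differential.\<close>

lemma dbar_fun_eq:
  assumes j: "linear (J p)" "\<And>v. J p (J p v) = - v" and f: "f differentiable (at p)"
  shows "dbar_fun J f p u = part01 (J p) (frechet_derivative f (at p)) u"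
proof -
  let ?D = "frechet_derivative f (at p)"
  have D: "linear ?D" using f by (rule linear_frechet_derivative)
  have one: "wedge_list (Suc 0) (\<lambda>i. \<beta>) v = \<beta> (v 0)" for \<beta> :: "'a \<Rightarrow> complex" and v
    using wedge_list_triangular[of "Suc 0" "\<lambda>i. \<beta>" v] by simp
  have ext: "ext_deriv 0 (\<lambda>p v. f p) p = wedge_list (Suc 0) (\<lambda>i. ?D)"
    by (auto simp: ext_deriv_def one fun_eq_iff)
  have "type_part (J p) 0 1 (ext_deriv 0 (\<lambda>p v. f p) p) = wedge_list (Suc 0) (\<lambda>i. part01 (J p) ?D)"
  proof (rule type_part_eq[OF j(1)])
    show "wedge_list (Suc 0) (\<lambda>i. part01 (J p) ?D) \<in> forms (J p) 0 1"
      using part01_in_forms01[OF j D] by (intro wedge_list_in_forms[of "{}"]) auto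
    have "ext_deriv 0 (\<lambda>p v. f p) p - wedge_list (Suc 0) (\<lambda>i. part01 (J p) ?D) =
        wedge_list (Suc 0) (\<lambda>i. part10 (J p) ?D)"
      unfolding ext by (auto simp: one fun_eq_iff algebra_simps simp flip: part10_add_part01[of "J p" ?D])
    moreover have "wedge_list (Suc 0) (\<lambda>i. part10 (J p) ?D) \<in> forms (J p) 1 0"
      using part10_in_forms10[OF j D] by (intro wedge_list_in_forms[of "{0}"]) auto
    ultimately show "ext_deriv 0 (\<lambda>p v. f p) p - wedge_list (Suc 0) (\<lambda>i. part01 (J p) ?D) \<in>
        cfun.span (\<Union>(a, b)\<in>{(a, b). a + b = 0 + 1 \<and> (a, b) \<noteq> (0, 1)}. forms (J p) a b)"
      by (intro cfun.span_base UN_I[of "(1, 0)"]) simp_all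
  qed
  then show ?thesis
    by (simp add: dbar_fun_def dbar_def one)
qed

section \<open>The invariant trivialisation of the canonical bundle\<close>

definition xcoord :: "'n \<Rightarrow> 'n::finite kt \<Rightarrow> complex"
  where "xcoord i v = of_real (vec_nth (fst v) i)"

definition ycoord :: "'n \<Rightarrow> 'n::finite kt \<Rightarrow> complex"
  where "ycoord i v = of_real (vec_nth (fst (snd v)) i)"

lemma coord_frame [simp]: "xcoord i (frame p v) = xcoord i v" "ycoord i (frame p v) = ycoord i v"
  by (simp_all add: xcoord_def ycoord_def)

lemma coord_fibre [simp]: "xcoord i fibre = 0" "ycoord i fibre = 0"
  by (simp_all add: xcoord_def ycoord_def fibre_def)

lemma linear_coord: "linear (xcoord i)" "linear (ycoord i)"
  by (auto intro!: linearI simp: xcoord_def ycoord_def complex_eq_iff)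

lemma inner_coord: "complex_of_real (inner (fst p) (fst (snd v))) = (\<Sum>i\<in>UNIV. xcoord i p * ycoord i v)"
  by (simp add: inner_vec_def xcoord_def ycoord_def)

lemma sum_apply: "(\<Sum>i\<in>I. F i) x = (\<Sum>i\<in>I. F i x)"
  by (induction I rule: infinite_finite_induct) auto

text \<open>Used to see that the canonical fibre and its tensor powers are lines: it suffices to
  check the generators.\<close>

lemma in_span_line:
  assumes "s \<in> cfun.span S" and "\<And>s. s \<in> S \<Longrightarrow> \<exists>c. s = cscale c \<omega>"
  obtains c where "s = cscale c \<omega>"
proof -
  have "S \<subseteq> cfun.span {\<omega>}"
    using assms(2) by (auto simp: cfun.span_singleton)
  then have "s \<in> cfun.span {\<omega>}"
    using assms(1) cfun.span_minimal[OF _ cfun.subspace_span] by blast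
  then show ?thesis
    using that by (auto simp: cfun.span_singleton)
qed

text \<open>\<open>\<alpha>\<close> is a basis of the (1,0)-forms at the origin, dual to \<open>e\<close>. Since \<open>e 0\<close> spans the centre,
  all \<open>\<alpha> i\<close> except \<open>\<alpha> 0\<close> are linear combinations of the closed forms \<open>dx\<close>, \<open>dy\<close>, \<open>dt\<close>.\<close>

locale kt_acs =
  fixes J :: "'n::finite kt \<Rightarrow> 'n kt \<Rightarrow> 'n kt" and e :: "nat \<Rightarrow> 'n kt" and \<alpha> :: "nat \<Rightarrow> 'n kt \<Rightarrow> complex"
    and n :: nat
  assumes n: "n = CARD('n)"
    and left_invariant: "left_invariant_acs J"
    and e_0: "e 0 = fibre"
    and \<alpha>_10: "\<And>i. i < Suc n \<Longrightarrow> \<alpha> i \<in> forms10 (J 0)"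
    and dual: "\<And>i l. i < Suc n \<Longrightarrow> l < Suc n \<Longrightarrow> \<alpha> i (e l) = (if i = l then 1 else 0)"
    and expand: "\<And>\<beta> v. \<beta> \<in> forms10 (J 0) \<Longrightarrow> \<beta> v = (\<Sum>i<Suc n. \<beta> (e i) * \<alpha> i v)"
begin

lemma acs: "almost_complex_structure KT J"
  using left_invariant by (simp add: left_invariant_acs_def)

lemma linear_J: "linear (J p)" and J_J: "J p (J p v) = - v" and smooth_J: "smooth_map (\<lambda>p. J p v)"
  using acs by (simp_all add: almost_complex_structure_def)

text \<open>An invariant field is determined by its value at the origin. Applied to the image under
  \<open>J\<close> of the field through \<open>v\<close>, this reduces \<open>J\<close> everywhere
  to the single map \<open>J 0\<close>.\<close>

lemma J_frame: "J p (frame p v) = frame p (J 0 v)"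
proof -
  have "left_invariant_field (\<lambda>p. frame p v)"
    by (simp add: left_invariant_field_def frame_kt_mult)
  then have "left_invariant_field (\<lambda>p. J p (frame p v))"
    using left_invariant by (simp add: left_invariant_acs_def)
  then have "J (kt_mult p 0) (frame (kt_mult p 0) v) = frame p (J 0 (frame 0 v))"
    by (simp add: left_invariant_field_def)
  moreover have "kt_mult p 0 = p"
    by (cases p) (simp add: zero_prod_def)
  ultimately show ?thesis by simp
qed

lemma J_frame_lattice: "g \<in> kt_lattice \<Longrightarrow> J (kt_mult g p) (frame g v) = frame g (J p v)"
  using acs by (auto simp: almost_complex_structure_def KT_def)

lemma frame_minus_J: "frame (- p) (J p v) = J 0 (frame (- p) v)"
  by (metis J_frame frame_minus_frame)

lemma forms10_frame: "\<beta> \<in> forms10 (J 0) \<Longrightarrow> (\<lambda>v. \<beta> (frame (- p) v)) \<in> forms10 (J p)"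
  using linear_compose[OF linear_frame, of \<beta> "- p"]
  by (auto simp: forms10_def frame_minus_J comp_def)

lemma forms10_frame': "\<beta> \<in> forms10 (J p) \<Longrightarrow> (\<lambda>v. \<beta> (frame p v)) \<in> forms10 (J 0)"
  using linear_compose[OF linear_frame, of \<beta> p]
  by (auto simp: forms10_def comp_def simp flip: J_frame)

lemma linear_\<alpha>: "i < Suc n \<Longrightarrow> linear (\<alpha> i)"
  using \<alpha>_10 by (auto simp: forms10_def)

text \<open>\<open>frame\<close> adds a multiple of \<open>fibre = e 0\<close>, which by duality
  only \<open>\<alpha> 0\<close> detects.\<close>

lemma \<alpha>_frame:
  assumes "i < Suc n"
  shows "\<alpha> i (frame p v) = \<alpha> i v + of_real (inner (fst p) (fst (snd v))) * (if i = 0 then 1 else 0)"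
  using dual[OF assms, of 0]
  by (simp add: frame_def e_0 linear_add[OF linear_\<alpha>[OF assms]] linear_scale[OF linear_\<alpha>[OF assms]]
      scaleR_conv_of_real)

abbreviation \<psi> :: "nat \<Rightarrow> 'n kt \<Rightarrow> complex"
  where "\<psi> \<equiv> \<lambda>i. \<alpha> (Suc i)"

text \<open>The left-invariant (1,0)-form with value \<open>\<alpha> i\<close> at the
  origin.\<close>

definition \<alpha>_at :: "'n kt \<Rightarrow> nat \<Rightarrow> 'n kt \<Rightarrow> complex"
  where "\<alpha>_at p i v = \<alpha> i (frame (- p) v)"

definition \<Omega> :: "'n kt \<Rightarrow> 'n kt form"
  where "\<Omega> p = wedge_list (Suc n) (\<alpha>_at p)"

lemma \<alpha>_at_10: "i < Suc n \<Longrightarrow> \<alpha>_at p i \<in> forms10 (J p)"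
  using forms10_frame[OF \<alpha>_10] by (simp add: \<alpha>_at_def[abs_def])

lemma \<alpha>_at_Suc: "i < n \<Longrightarrow> \<alpha>_at p (Suc i) v = \<psi> i v"
  by (simp add: \<alpha>_at_def \<alpha>_frame)

lemma \<psi>_10: "i < n \<Longrightarrow> \<psi> i \<in> forms10 (J p)"
  using \<alpha>_at_10[of "Suc i" p] ext[of "\<alpha>_at p (Suc i)" "\<psi> i"] by (simp add: \<alpha>_at_Suc)

lemma \<Omega>_case: "\<Omega> p v = wedge_list (Suc n) (case_nat (\<alpha>_at p 0) \<psi>) v"
  unfolding \<Omega>_def by (rule wedge_list_cong) (auto simp: \<alpha>_at_Suc split: nat.splits)

text \<open>The factor of index 0 is \<open>\<alpha> 0\<close> minus the sum of the x_i dy_i and all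
  others are constant, so \<Omega> is affine in the x-coordinates of \<open>p\<close> and its
  derivative can be read off.\<close>

lemma \<Omega>_affine:
  "\<Omega> p v = \<Omega> 0 v - (\<Sum>i\<in>UNIV. xcoord i p * wedge_list (Suc n) (case_nat (ycoord i) \<psi>) v)"
proof -
  have eq: "\<alpha>_at p 0 = (\<lambda>u. \<alpha>_at 0 0 u + (\<Sum>i\<in>UNIV. - xcoord i p * ycoord i u))"
    by (rule ext) (simp add: \<alpha>_at_def \<alpha>_frame inner_coord sum_negf)
  show ?thesis
    unfolding \<Omega>_case eq wedge_list_case_nat_add wedge_list_case_nat_sum
    by (simp add: sum_negf)
qed

lemma smooth_\<Omega>: "smooth_map (\<lambda>p. \<Omega> p v)"
proof -
  have "smooth_map (\<lambda>p. \<Omega> 0 v + (\<Sum>i\<in>UNIV. xcoord i p * - wedge_list (Suc n) (case_nat (ycoord i) \<psi>) v))"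
    by (intro smooth_map_add smooth_map_sum smooth_map_mult smooth_map_const smooth_map_bounded_linear)
       (use linear_coord linear_conv_bounded_linear in blast)
  then show ?thesis
    by (subst \<Omega>_affine) (simp add: sum_negf)
qed

lemma frechet_derivative_\<Omega>:
  "frechet_derivative (\<lambda>p. \<Omega> p v) (at p) u =
    - (\<Sum>i\<in>UNIV. xcoord i u * wedge_list (Suc n) (case_nat (ycoord i) \<psi>) v)"
proof -
  have [derivative_intros]: "(xcoord i has_derivative xcoord i) F" for i :: 'n and F
    using linear_coord linear_conv_bounded_linear by (blast intro: bounded_linear_imp_has_derivative)
  have "((\<lambda>p. \<Omega> 0 v - (\<Sum>i\<in>UNIV. xcoord i p * wedge_list (Suc n) (case_nat (ycoord i) \<psi>) v)) has_derivative
      (\<lambda>u. - (\<Sum>i\<in>UNIV. xcoord i u * wedge_list (Suc n) (case_nat (ycoord i) \<psi>) v))) (at p)"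
    by (rule has_derivative_eq_rhs, (rule derivative_intros)+) (simp add: fun_eq_iff)
  then show ?thesis
    by (simp add: frechet_derivative_at[symmetric] flip: \<Omega>_affine)
qed

text \<open>In the constant frame \<open>e\<close> the matrix of the forms \<open>\<alpha>_at p\<close> is unitriangular.\<close>

lemma \<Omega>_e [simp]: "\<Omega> p e = 1"
proof -
  have "\<Omega> p e = (\<Prod>i<Suc n. \<alpha>_at p i (e i))"
    unfolding \<Omega>_def
    by (rule wedge_list_triangular) (auto simp: \<alpha>_at_def \<alpha>_frame dual)
  also have "\<dots> = 1"
    by (intro prod.neutral) (auto simp: \<alpha>_at_def \<alpha>_frame dual e_0 fibre_def)
  finally show ?thesis .
qed

lemma \<Omega>_kt_mult [simp]: "\<Omega> (kt_mult g p) (\<lambda>l. frame g (v l)) = \<Omega> p v"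
  unfolding \<Omega>_def by (rule wedge_list_cong) (simp add: \<alpha>_at_def)

text \<open>Transporting each factor to the origin by \<open>frame p\<close> allows it to be
  expanded in \<alpha>; in top degree the change of basis is a determinant factor.\<close>

lemma wedge_list_\<Omega>:
  assumes "\<And>i. i < Suc n \<Longrightarrow> \<beta> i \<in> forms10 (J p)"
  shows "wedge_list (Suc n) \<beta> v = wedge_list (Suc n) \<beta> (\<lambda>l. frame p (e l)) * \<Omega> p v"
  unfolding \<Omega>_def
proof (rule wedge_list_change_basis)
  fix i l assume "i < Suc n"
  then show "\<beta> i (v l) = (\<Sum>r<Suc n. \<beta> i (frame p (e r)) * \<alpha>_at p r (v l))"
    using expand[OF forms10_frame'[OF assms], of i "frame (- p) (v l)"] by (simp add: \<alpha>_at_def)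
qed

text \<open>Modulo the \<psi> a (1,0)-form is its value on \<open>fibre\<close> times
  \<open>\<alpha>_at p 0\<close>, because the \<psi> together with that form are a basis and the
  \<psi> vanish on \<open>fibre\<close>.\<close>

lemma wedge_list_10_\<psi>:
  assumes "\<beta> \<in> forms10 (J p)"
  shows "wedge_list (Suc n) (case_nat \<beta> \<psi>) v = \<beta> fibre * \<Omega> p v"
proof -
  have "wedge_list (Suc n) (case_nat \<beta> \<psi>) (\<lambda>l. frame p (e l)) =
      (\<Prod>i<Suc n. case_nat \<beta> \<psi> i (frame p (e i)))"
    by (rule wedge_list_triangular) (auto simp: \<alpha>_frame dual split: nat.splits)
  also have "\<dots> = \<beta> fibre * (\<Prod>i<n. \<psi> i (frame p (e (Suc i))))"
    unfolding prod.lessThan_Suc_shift by (simp add: e_0)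
  also have "(\<Prod>i<n. \<psi> i (frame p (e (Suc i)))) = 1"
    by (intro prod.neutral) (auto simp: \<alpha>_frame dual)
  finally show ?thesis
    using wedge_list_\<Omega>[of "case_nat \<beta> \<psi>" p v] assms \<psi>_10 by (auto split: nat.splits)
qed

section \<open>Sections of the canonical bundle and its powers as scalar functions\<close>

lemma \<Omega>_in_canon: "\<Omega> p \<in> canon (J p)"
  unfolding canon_def DIM_kt n[symmetric] \<Omega>_def
  by (rule wedge_list_in_forms[of "{..<Suc n}"]) (auto simp: \<alpha>_at_10)

text \<open>The fibre is the line through \<open>\<Omega> p\<close>, and since \<Omega> is 1 on
  \<open>e\<close>, evaluation at \<open>e\<close> reads off the coefficient.\<close>

lemma canon_eq:
  assumes "\<phi> \<in> canon (J p)"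
  shows "\<phi> v = \<phi> e * \<Omega> p v"
proof -
  obtain c where "\<phi> = cscale c (\<Omega> p)"
    using assms unfolding canon_def DIM_kt n[symmetric] forms_def
  proof (rule in_span_line)
    fix \<omega> assume "\<omega> \<in> {wedge_list (Suc n + 0) \<alpha> |\<alpha>.
      (\<forall>i<Suc n. \<alpha> i \<in> forms10 (J p)) \<and> (\<forall>i\<in>{Suc n..<Suc n + 0}. \<alpha> i \<in> forms01 (J p))}"
    then obtain \<beta> where "\<omega> = wedge_list (Suc n) \<beta>" "\<And>i. i < Suc n \<Longrightarrow> \<beta> i \<in> forms10 (J p)"
      by auto
    then show "\<exists>c. \<omega> = cscale c (\<Omega> p)"
      using wedge_list_\<Omega>[of \<beta> p] unfolding cscale_def by blast
  qed
  then have c: "\<phi> v = c * \<Omega> p v" for v by (simp add: cscale_def)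
  show ?thesis unfolding c by simp
qed

definition \<Omega>_pow :: "nat \<Rightarrow> 'n kt \<Rightarrow> (nat \<Rightarrow> nat \<Rightarrow> 'n kt) \<Rightarrow> complex"
  where "\<Omega>_pow N p = tensor N (\<lambda>i. \<Omega> p)"

lemma \<Omega>_pow_e [simp]: "\<Omega>_pow N p (\<lambda>i. e) = 1"
  by (simp add: \<Omega>_pow_def tensor_def)

lemma \<Omega>_pow_kt_mult [simp]: "\<Omega>_pow N (kt_mult g p) (act_blocks (frame g) w) = \<Omega>_pow N p w"
  by (simp add: \<Omega>_pow_def tensor_def act_blocks_def)

lemma smooth_\<Omega>_pow: "smooth_map (\<lambda>p. \<Omega>_pow N p w)"
  unfolding \<Omega>_pow_def tensor_def by (intro smooth_map_prod smooth_\<Omega>)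

lemma \<Omega>_pow_in_canon_pow: "\<Omega>_pow N p \<in> canon_pow N (J p)"
  unfolding canon_pow_def \<Omega>_pow_def using \<Omega>_in_canon[of p] by (intro cfun.span_base) blast

lemma canon_pow_eq:
  assumes "s \<in> canon_pow N (J p)"
  shows "s w = s (\<lambda>i. e) * \<Omega>_pow N p w"
proof -
  obtain c where "s = cscale c (\<Omega>_pow N p)"
    using assms unfolding canon_pow_def
  proof (rule in_span_line)
    fix s assume "s \<in> {tensor N \<phi> |\<phi>. \<forall>i<N. \<phi> i \<in> canon (J p)}"
    then obtain \<phi> where \<phi>: "s = tensor N \<phi>" "\<And>i. i < N \<Longrightarrow> \<phi> i \<in> canon (J p)"
      by auto
    then have "(\<Prod>i<N. \<phi> i (w i)) = (\<Prod>i<N. \<phi> i e) * (\<Prod>i<N. \<Omega> p (w i))" for w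
      unfolding prod.distrib[symmetric] by (intro prod.cong) (auto intro: canon_eq)
    then have "s = cscale (\<Prod>i<N. \<phi> i e) (\<Omega>_pow N p)"
      unfolding \<phi>(1) tensor_def \<Omega>_pow_def cscale_def by (intro ext)
    then show "\<exists>c. s = cscale c (\<Omega>_pow N p)" by blast
  qed
  then have c: "s w = c * \<Omega>_pow N p w" for w by (simp add: cscale_def)
  show ?thesis unfolding c by simp
qed

lemma canon_pow_subspace: "cfun.subspace (canon_pow N j)"
  by (simp add: canon_pow_def)

lemma canon_sectionsI: "smooth_fun KT f \<Longrightarrow> (\<lambda>p v. f p * \<Omega> p v) \<in> canon_sections KT J"
  using smooth_\<Omega> \<Omega>_in_canon
  unfolding canon_sections_def smooth_section_def smooth_fun_def act_form_def KT_def canon_def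
  by (simp add: smooth_map_mult cfun.subspace_scale[OF forms_subspace, unfolded cscale_def])

lemma canon_sectionsE:
  assumes "\<phi> \<in> canon_sections KT J"
  obtains f where "smooth_fun KT f" "\<phi> = (\<lambda>p v. f p * \<Omega> p v)"
proof
  have \<phi>: "\<phi> p v = \<phi> p e * \<Omega> p v" for p v
    using assms canon_eq by (simp add: canon_sections_def smooth_section_def)
  have "\<phi> (kt_mult g p) e = \<phi> p e" if "g \<in> kt_lattice" for g p
  proof -
    \<comment> \<open>The vectors \<open>e\<close> are constant rather than invariant, so invariance
      of \<open>\<phi>\<close> is available on the translated ones only; \<Omega> takes the value 1
      on both, which gives the same coefficient.\<close>
    have "\<phi> (kt_mult g p) (\<lambda>l. frame g (e l)) = \<phi> p e"
      using assms that by (auto simp: canon_sections_def smooth_section_def act_form_def KT_def)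
    then show ?thesis using \<phi>[of "kt_mult g p" "\<lambda>l. frame g (e l)"] by simp
  qed
  then show "smooth_fun KT (\<lambda>p. \<phi> p e)"
    using assms by (auto simp: smooth_fun_def canon_sections_def smooth_section_def KT_def)
  show "\<phi> = (\<lambda>p v. \<phi> p e * \<Omega> p v)"
    using \<phi> by blast
qed

lemma pluricanon_sectionsI: "smooth_fun KT f \<Longrightarrow> (\<lambda>p w. f p * \<Omega>_pow N p w) \<in> pluricanon_sections KT J N"
  using smooth_\<Omega>_pow \<Omega>_pow_in_canon_pow
  unfolding pluricanon_sections_def smooth_section_def smooth_fun_def KT_def
  by (simp add: smooth_map_mult cfun.subspace_scale[OF canon_pow_subspace, unfolded cscale_def])

lemma pluricanon_sectionsE:
  assumes "s \<in> pluricanon_sections KT J N"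
  shows "smooth_fun KT (\<lambda>p. s p (\<lambda>i. e))" "s = (\<lambda>p w. s p (\<lambda>i. e) * \<Omega>_pow N p w)"
proof -
  have s: "s p w = s p (\<lambda>i. e) * \<Omega>_pow N p w" for p w
    using assms canon_pow_eq by (simp add: pluricanon_sections_def smooth_section_def)
  have "s (kt_mult g p) (\<lambda>i. e) = s p (\<lambda>i. e)" if "g \<in> kt_lattice" for g p
  proof -
    have "s (kt_mult g p) (act_blocks (frame g) (\<lambda>i. e)) = s p (\<lambda>i. e)"
      using assms that by (auto simp: pluricanon_sections_def smooth_section_def KT_def)
    then show ?thesis using s[of "kt_mult g p" "act_blocks (frame g) (\<lambda>i. e)"] by simp
  qed
  then show "smooth_fun KT (\<lambda>p. s p (\<lambda>i. e))"
    using assms by (auto simp: smooth_fun_def pluricanon_sections_def smooth_section_def KT_def)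
  show "s = (\<lambda>p w. s p (\<lambda>i. e) * \<Omega>_pow N p w)"
    using s by blast
qed

section \<open>The operator dbar in the trivialisation\<close>

abbreviation \<d> :: "('n kt \<Rightarrow> complex) \<Rightarrow> 'n kt \<Rightarrow> 'n kt \<Rightarrow> complex"
  where "\<d> f p \<equiv> frechet_derivative f (at p)"

definition dbf :: "('n kt \<Rightarrow> complex) \<Rightarrow> 'n kt \<Rightarrow> 'n kt \<Rightarrow> complex"
  where "dbf f p = part01 (J p) (\<d> f p)"

text \<open>The factor in dbar \<Omega> = \<theta> \<and> \<Omega>. In minus the sum of dx_i \<and>
  dy_i \<and> \<psi>, keep the terms with one (1,0)- and one (0,1)-factor among dx_i and dy_i; in
  front of \<psi>, a (1,0)-factor becomes its value on \<open>fibre\<close> times \<Omega>.\<close>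

definition \<theta> :: "'n kt \<Rightarrow> 'n kt \<Rightarrow> complex"
  where "\<theta> p u = (\<Sum>i\<in>UNIV. part10 (J p) (xcoord i) fibre * part01 (J p) (ycoord i) u -
    part10 (J p) (ycoord i) fibre * part01 (J p) (xcoord i) u)"

lemma \<theta>_01: "\<theta> p \<in> forms01 (J p)"
proof -
  note 01 = part01_in_forms01[OF linear_J J_J]
  have "(\<lambda>u. \<Sum>i\<in>UNIV. part10 (J p) (xcoord i) fibre * part01 (J p) (ycoord i) u +
    - part10 (J p) (ycoord i) fibre * part01 (J p) (xcoord i) u) \<in> forms01 (J p)"
    by (intro forms01_sum forms01_add forms01_scale 01 linear_coord)
  then show ?thesis by (simp add: \<theta>_def[abs_def])
qed

lemma dbf_01: "smooth_map f \<Longrightarrow> dbf f p \<in> forms01 (J p)"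
  unfolding dbf_def
  by (intro part01_in_forms01 linear_J J_J linear_frechet_derivative smooth_map_differentiable)

lemma dbar_fun_dbf: "smooth_map f \<Longrightarrow> dbar_fun J f p u = dbf f p u"
  unfolding dbf_def by (intro dbar_fun_eq linear_J J_J smooth_map_differentiable)

lemma part_frame:
  "part10 (J p) (xcoord i) (frame p u) = part10 (J 0) (xcoord i) u"
  "part10 (J p) (ycoord i) (frame p u) = part10 (J 0) (ycoord i) u"
  "part01 (J p) (xcoord i) (frame p u) = part01 (J 0) (xcoord i) u"
  "part01 (J p) (ycoord i) (frame p u) = part01 (J 0) (ycoord i) u"
  by (simp_all add: part10_def part01_def J_frame)

lemma \<theta>_frame: "\<theta> p (frame p u) = \<theta> 0 u"
  using part_frame(1,2)[of p _ fibre] unfolding \<theta>_def by (simp add: part_frame(3,4))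

lemma \<theta>_kt_mult: "\<theta> (kt_mult g p) (frame g u) = \<theta> p u"
  using \<theta>_frame[of "kt_mult g p" "frame (- p) u"] \<theta>_frame[of p "frame (- p) u"]
  by (simp add: frame_kt_mult)

text \<open>As dx_i and dy_i vanish on \<open>fibre\<close>, their (1,0)- and (0,1)-parts there are
  opposite, so the two products in each summand cancel.\<close>

lemma \<theta>_fibre: "\<theta> p fibre = 0"
  by (simp add: \<theta>_def part10_def part01_def)

text \<open>The product rule d(f \<Omega>) = df \<and> \<Omega> + f d\<Omega>, with d\<Omega> equal
  to minus the sum of dx_i \<and> dy_i \<and> \<psi> by the affine formula for \<Omega>.\<close>

lemma ext_deriv_\<Omega>:
  assumes f: "smooth_map f"
  shows "ext_deriv (Suc n) (\<lambda>p v. f p * \<Omega> p v) p v =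
    wedge_list (Suc (Suc n)) (case_nat (\<d> f p) (\<alpha>_at p)) v -
    f p * (\<Sum>i\<in>UNIV. wedge_list (Suc (Suc n)) (case_nat (xcoord i) (case_nat (ycoord i) \<psi>)) v)"
proof -
  have D: "\<d> (\<lambda>q. f q * \<Omega> q w) p u = \<d> f p u * \<Omega> p w -
      f p * (\<Sum>i\<in>UNIV. xcoord i u * wedge_list (Suc n) (case_nat (ycoord i) \<psi>) w)" for w u
  proof -
    have "((\<lambda>q. f q * \<Omega> q w) has_derivative
        (\<lambda>u. f p * \<d> (\<lambda>q. \<Omega> q w) p u + \<d> f p u * \<Omega> p w)) (at p)"
      by (intro has_derivative_mult smooth_map_has_derivative f smooth_\<Omega>)
    from frechet_derivative_at[OF this, symmetric] show ?thesis
      by (simp add: frechet_derivative_\<Omega>)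
  qed
  have "ext_deriv (Suc n) (\<lambda>p v. f p * \<Omega> p v) p v =
      (\<Sum>l\<le>Suc n. (- 1) ^ l * (\<d> f p (v l) * \<Omega> p (omit l v))) -
      (\<Sum>l\<le>Suc n. f p * (\<Sum>i\<in>UNIV. (- 1) ^ l *
        (xcoord i (v l) * wedge_list (Suc n) (case_nat (ycoord i) \<psi>) (omit l v))))"
    unfolding ext_deriv_def D sum_subtractf[symmetric] sum_distrib_left
    by (simp add: algebra_simps sum_distrib_left)
  also have "(\<Sum>l\<le>Suc n. f p * (\<Sum>i\<in>UNIV. (- 1) ^ l *
        (xcoord i (v l) * wedge_list (Suc n) (case_nat (ycoord i) \<psi>) (omit l v)))) =
      f p * (\<Sum>i\<in>UNIV. \<Sum>l\<le>Suc n. (- 1) ^ l *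
        (xcoord i (v l) * wedge_list (Suc n) (case_nat (ycoord i) \<psi>) (omit l v)))"
    unfolding sum_distrib_left by (rule sum.swap)
  finally show ?thesis
    unfolding wedge_list_case_nat[of "Suc n"] \<Omega>_def .
qed

lemma wedge_list_01_10:
  assumes "\<beta> \<in> forms10 (J p)"
  shows "wedge_list (Suc (Suc n)) (case_nat \<gamma> (case_nat \<beta> \<psi>)) v =
    \<beta> fibre * wedge_list (Suc (Suc n)) (case_nat \<gamma> (\<alpha>_at p)) v"
  unfolding wedge_list_case_nat[of "Suc n"] wedge_list_10_\<psi>[OF assms] \<Omega>_def
  by (simp add: sum_distrib_left mult_ac del: sum.atMost_Suc)

text \<open>Splitting df, dx_i and dy_i by type leaves, besides the mixed terms that form \<theta>,
  pieces of types (n+2,0) and (n,2). The latter reflect a possible lack of integrability and go into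
  the remainder.\<close>

lemma type_part_ext_deriv_\<Omega>:
  assumes f: "smooth_map f"
  shows "type_part (J p) (Suc n) 1 (ext_deriv (Suc n) (\<lambda>p v. f p * \<Omega> p v) p) =
    wedge_list (Suc (Suc n)) (case_nat (\<lambda>u. dbf f p u + f p * \<theta> p u) (\<alpha>_at p))"
proof (rule type_part_eq[OF linear_J])
  let ?j = "J p" and ?m = "Suc (Suc n)"
  let ?U = "\<Union>(a, b)\<in>{(a, b). a + b = Suc n + 1 \<and> (a, b) \<noteq> (Suc n, 1)}. forms (J p) a b"
  let ?\<eta> = "wedge_list ?m (case_nat (\<lambda>u. dbf f p u + f p * \<theta> p u) (\<alpha>_at p))"
  note 10 = part10_in_forms10[OF linear_J[of p] J_J[of p]] and 01 = part01_in_forms01[OF linear_J[of p] J_J[of p]]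
  have "(\<lambda>u. dbf f p u + f p * \<theta> p u) \<in> forms01 ?j"
    by (intro forms01_add forms01_scale dbf_01 f \<theta>_01)
  then show "?\<eta> \<in> forms ?j (Suc n) 1"
    using \<alpha>_at_10 by (intro wedge_list_in_forms[of "{1..<?m}"]) (auto split: nat.splits)
  define W where "W \<beta> \<gamma> = wedge_list ?m (case_nat \<beta> (case_nat \<gamma> \<psi>))" for \<beta> \<gamma>
  define X where "X = part10 ?j \<circ> xcoord"
  define X' where "X' = part01 ?j \<circ> xcoord"
  define Y where "Y = part10 ?j \<circ> ycoord"
  define Y' where "Y' = part01 ?j \<circ> ycoord"
  have types: "X i \<in> forms10 ?j" "Y i \<in> forms10 ?j" "X' i \<in> forms01 ?j" "Y' i \<in> forms01 ?j" for i
    by (simp_all add: X_def X'_def Y_def Y'_def 10 01 linear_coord)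
  have Wsplit: "W (xcoord i) (ycoord i) v = W (X i) (Y i) v + W (X i) (Y' i) v + W (X' i) (Y i) v + W (X' i) (Y' i) v"
    for i v
  proof -
    have "xcoord i = (\<lambda>u. X i u + X' i u)" "ycoord i = (\<lambda>u. Y i u + Y' i u)"
      by (auto simp: X_def X'_def Y_def Y'_def part10_add_part01)
    then show ?thesis
      by (simp add: W_def wedge_list_case_nat_add wedge_list_case_nat_add2)
  qed
  have mixed: "W (X i) (Y' i) v + W (X' i) (Y i) v =
      - wedge_list ?m (case_nat (\<lambda>u. X i fibre * Y' i u - Y i fibre * X' i u) (\<alpha>_at p)) v" for i v
  proof -
    \<comment> \<open>The swap brings the (1,0)-factor next to \<psi>, where it can be absorbed into
      \<Omega>; its sign is responsible for the minus sign in \<theta>.\<close>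
    have "W (X i) (Y' i) v = - W (Y' i) (X i) v"
      unfolding W_def by (rule wedge_list_swap)
    then have "W (X i) (Y' i) v + W (X' i) (Y i) v =
        Y i fibre * wedge_list ?m (case_nat (X' i) (\<alpha>_at p)) v -
        X i fibre * wedge_list ?m (case_nat (Y' i) (\<alpha>_at p)) v"
      unfolding W_def by (simp add: wedge_list_01_10[OF types(1)] wedge_list_01_10[OF types(2)])
    then show ?thesis
      unfolding wedge_list_case_nat[of "Suc n"]
      by (simp add: algebra_simps sum_subtractf sum_distrib_left del: sum.atMost_Suc)
  qed
  have "(\<Sum>i\<in>UNIV. W (X i) (Y' i) v + W (X' i) (Y i) v) = - wedge_list ?m (case_nat (\<theta> p) (\<alpha>_at p)) v" for v
  proof -
    have "\<theta> p = (\<lambda>u. \<Sum>i\<in>UNIV. X i fibre * Y' i u - Y i fibre * X' i u)"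
      by (simp add: \<theta>_def[abs_def] X_def X'_def Y_def Y'_def)
    then show ?thesis
      by (simp only: mixed sum_negf wedge_list_case_nat_sum[where c = "\<lambda>_. 1", simplified])
  qed
  note mixed_sum = this
  have \<eta>: "?\<eta> v = wedge_list ?m (case_nat (dbf f p) (\<alpha>_at p)) v +
      f p * wedge_list ?m (case_nat (\<theta> p) (\<alpha>_at p)) v" for v
    unfolding wedge_list_case_nat[of "Suc n"]
    by (simp add: algebra_simps sum.distrib sum_distrib_left del: sum.atMost_Suc)
  have df: "wedge_list ?m (case_nat (\<d> f p) (\<alpha>_at p)) v =
      wedge_list ?m (case_nat (part10 ?j (\<d> f p)) (\<alpha>_at p)) v + wedge_list ?m (case_nat (dbf f p) (\<alpha>_at p)) v" for v
  proof -
    have "\<d> f p = (\<lambda>u. part10 ?j (\<d> f p) u + dbf f p u)"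
      by (simp add: dbf_def part10_add_part01)
    then show ?thesis
      using wedge_list_case_nat_add by metis
  qed
  have eq: "ext_deriv (Suc n) (\<lambda>p v. f p * \<Omega> p v) p - ?\<eta> =
      wedge_list ?m (case_nat (part10 ?j (\<d> f p)) (\<alpha>_at p)) -
      cscale (f p) (\<Sum>i\<in>UNIV. W (X i) (Y i) + W (X' i) (Y' i))" (is "?l = ?r")
  proof
    fix v
    have "(\<Sum>i\<in>UNIV. W (xcoord i) (ycoord i) v) =
        (\<Sum>i\<in>UNIV. W (X i) (Y i) v + W (X' i) (Y' i) v) + (\<Sum>i\<in>UNIV. W (X i) (Y' i) v + W (X' i) (Y i) v)"
      unfolding Wsplit by (simp add: sum.distrib)
    then have S: "(\<Sum>i\<in>UNIV. wedge_list ?m (case_nat (xcoord i) (case_nat (ycoord i) \<psi>)) v) =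
        (\<Sum>i\<in>UNIV. W (X i) (Y i) v + W (X' i) (Y' i) v) - wedge_list ?m (case_nat (\<theta> p) (\<alpha>_at p)) v"
      unfolding mixed_sum by (simp add: W_def)
    have T: "(\<Sum>i\<in>UNIV. W (X i) (Y i) + W (X' i) (Y' i)) v = (\<Sum>i\<in>UNIV. W (X i) (Y i) v + W (X' i) (Y' i) v)"
      by (simp add: sum_apply)
    show "?l v = ?r v"
      unfolding fun_diff_def cscale_def ext_deriv_\<Omega>[OF f] \<eta> df S T by (simp add: right_diff_distrib)
  qed
  have "wedge_list ?m (case_nat (part10 ?j (\<d> f p)) (\<alpha>_at p)) \<in> forms ?j (Suc (Suc n)) 0"
    using \<alpha>_at_10 10[OF linear_frechet_derivative[OF smooth_map_differentiable[OF f]]]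
    by (intro wedge_list_in_forms[of "{..<?m}"]) (auto split: nat.splits)
  then have 1: "wedge_list ?m (case_nat (part10 ?j (\<d> f p)) (\<alpha>_at p)) \<in> cfun.span ?U"
    by (intro cfun.span_base UN_I[of "(Suc (Suc n), 0)"]) simp_all
  have "W (X i) (Y i) \<in> forms ?j (Suc (Suc n)) 0" for i
    unfolding W_def using types \<psi>_10 by (intro wedge_list_in_forms[of "{..<?m}"]) (auto split: nat.splits)
  then have 2: "W (X i) (Y i) \<in> cfun.span ?U" for i
    by (intro cfun.span_base UN_I[of "(Suc (Suc n), 0)"]) simp_all
  have "W (X' i) (Y' i) \<in> forms ?j n 2" for i
    unfolding W_def using types \<psi>_10
    by (intro wedge_list_in_forms[of "{2..<?m}"]) (auto split: nat.splits)
  then have 3: "W (X' i) (Y' i) \<in> cfun.span ?U" for i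
    by (intro cfun.span_base UN_I[of "(n, 2)"]) simp_all
  show "ext_deriv (Suc n) (\<lambda>p v. f p * \<Omega> p v) p - ?\<eta> \<in> cfun.span ?U"
    unfolding eq by (intro cfun.span_diff cfun.span_scale cfun.span_sum cfun.span_add 1 2 3)
qed

text \<open>Because the canonical fibre is a line, every sum of decomposable tensors is decomposable
  with second factor \<Omega>.\<close>

lemma valued01_eq:
  assumes "\<sigma> \<in> valued01 (J p) (canon (J p))"
  obtains \<theta>' where "\<theta>' \<in> forms01 (J p)" "\<sigma> = (\<lambda>(u, t). \<theta>' u * \<Omega> p t)"
proof -
  have "\<exists>\<theta>'\<in>forms01 (J p). \<sigma> = (\<lambda>(u, t). \<theta>' u * \<Omega> p t)"
    using assms unfolding valued01_def
  proof (induction rule: cfun.span_induct)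
    case base
    have "0 = (\<lambda>(u, t). 0 * \<Omega> p t)"
      by auto
    then have "\<exists>\<theta>'\<in>forms01 (J p). 0 = (\<lambda>(u, t). \<theta>' u * \<Omega> p t)"
      using forms01_zero by (intro bexI[of _ "\<lambda>u. 0"]) auto
    moreover have "\<exists>\<theta>'\<in>forms01 (J p). (\<lambda>(u, t). \<beta> u * \<Omega> p t) + (\<lambda>(u, t). \<gamma> u * \<Omega> p t) = (\<lambda>(u, t). \<theta>' u * \<Omega> p t)"
      if "\<beta> \<in> forms01 (J p)" "\<gamma> \<in> forms01 (J p)" for \<beta> \<gamma>
      using that by (intro bexI[of _ "\<lambda>u. \<beta> u + \<gamma> u"] forms01_add) (auto simp: fun_eq_iff algebra_simps)
    moreover have "\<exists>\<theta>'\<in>forms01 (J p). cscale c (\<lambda>(u, t). \<beta> u * \<Omega> p t) = (\<lambda>(u, t). \<theta>' u * \<Omega> p t)"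
      if "\<beta> \<in> forms01 (J p)" for \<beta> c
      using that by (intro bexI[of _ "\<lambda>u. c * \<beta> u"] forms01_scale) (auto simp: fun_eq_iff cscale_def)
    ultimately show ?case
      unfolding cfun.subspace_def by blast
  next
    case (step \<sigma>)
    then obtain \<beta> s where s: "\<sigma> = (\<lambda>(u, t). \<beta> u * s t)" "\<beta> \<in> forms01 (J p)" "s \<in> canon (J p)"
      by blast
    have "\<beta> u * s t = (s e * \<beta> u) * \<Omega> p t" for u t
      using canon_eq[OF s(3), of t] by simp
    then have "\<sigma> = (\<lambda>(u, t). (s e * \<beta> u) * \<Omega> p t)"
      by (simp only: s(1))
    then show ?case
      using forms01_scale[OF s(2), of "s e"] by (intro bexI[of _ "\<lambda>u. s e * \<beta> u"])
  qed
  then show ?thesis using that by blast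
qed

text \<open>Evaluate at \<open>u + \<i> j u\<close> in the first slot: this vector is annihilated by all (1,0)-forms.\<close>

lemma wedge_01_\<Omega>_eq_0:
  assumes \<beta>: "\<beta> \<in> forms01 (J p)" and 0: "\<And>v. wedge_list (Suc (Suc n)) (case_nat \<beta> (\<alpha>_at p)) v = 0"
  shows "\<beta> u = 0"
proof -
  define v where "v u = case_nat u e" for u
  \<comment> \<open>Once a later slot is omitted, \<open>u\<close> still fills column 0. The
    (1,0)-forms are complex linear there, so replacing \<open>u\<close> by \<open>J p u\<close>
    multiplies the determinant by \<i>.\<close>
  have tail: "wedge_list (Suc n) (\<alpha>_at p) (omit (Suc i) (v (J p u))) =
      \<i> * wedge_list (Suc n) (\<alpha>_at p) (omit (Suc i) (v u))" for i
  proof -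
    have *: "\<alpha>_at p r (J p u) = \<i> * \<alpha>_at p r u" if "r < Suc n" for r
      using \<alpha>_at_10[OF that] by (simp add: forms10_def)
    have "Determinant.det (Matrix.mat (Suc n) (Suc n) (\<lambda>(r, l). \<alpha>_at p r (omit (Suc i) (v (J p u)) l))) =
      \<i> * Determinant.det (Matrix.mat (Suc n) (Suc n) (\<lambda>(r, l). \<alpha>_at p r (omit (Suc i) (v u) l)))"
    proof -
      let ?A = "Matrix.mat (Suc n) (Suc n) (\<lambda>(r, l). \<alpha>_at p r (omit (Suc i) (v (J p u)) l))"
      let ?B = "Matrix.mat (Suc n) (Suc n) (\<lambda>(r, l). \<alpha>_at p r (omit (Suc i) (v u) l))"
      have "mat_delete ?A r 0 = mat_delete ?B r 0" if "r < Suc n" for r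
        by (intro eq_matI) (auto simp: mat_delete_def omit_def v_def split: nat.splits)
      then have "?A $$ (r, 0) * cofactor ?A r 0 = \<i> * (?B $$ (r, 0) * cofactor ?B r 0)" if "r < Suc n" for r
        using that by (simp add: cofactor_def omit_def v_def *)
      then have "(\<Sum>r<Suc n. ?A $$ (r, 0) * cofactor ?A r 0) = \<i> * (\<Sum>r<Suc n. ?B $$ (r, 0) * cofactor ?B r 0)"
        unfolding sum_distrib_left by (intro sum.cong) auto
      then show ?thesis
        by (subst (1 2) laplace_expansion_column[of _ "Suc n" 0]) simp_all
    qed
    then show ?thesis by (simp only: wedge_list_det)
  qed
  have exp: "wedge_list (Suc (Suc n)) (case_nat \<beta> (\<alpha>_at p)) (v u) =
      \<beta> u + (\<Sum>i\<le>n. (- 1) ^ Suc i * (\<beta> (e i) * wedge_list (Suc n) (\<alpha>_at p) (omit (Suc i) (v u))))" for u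
  proof -
    have "omit 0 (v u) = e"
      by (auto simp: omit_def v_def)
    then show ?thesis
      unfolding wedge_list_case_nat[of "Suc n"] sum.atMost_Suc_shift
      using \<Omega>_e[of p] by (simp add: v_def \<Omega>_def)
  qed
  have "0 = wedge_list (Suc (Suc n)) (case_nat \<beta> (\<alpha>_at p)) (v u) +
      \<i> * wedge_list (Suc (Suc n)) (case_nat \<beta> (\<alpha>_at p)) (v (J p u))"
    using 0 by simp
  \<comment> \<open>The tails enter once with factor 1 and once with factor \<i> times \<i>, and
    cancel.\<close>
  also have "\<dots> = \<beta> u + \<i> * \<beta> (J p u)"
    unfolding exp tail mult.left_commute[of _ \<i>] sum_distrib_left[symmetric] by (simp add: algebra_simps)
  also have "\<dots> = 2 * \<beta> u"
    using \<beta> by (simp add: forms01_def)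
  finally show ?thesis by simp
qed

text \<open>The inverse in \<open>dbar_canon\<close> is meaningful once wedging is injective on
  canonical-valued (0,1)-forms; the preimage of the (n+1,1)-component of d(f \<Omega>) is then
  visible.\<close>

lemma dbar_canon_\<Omega>:
  assumes f: "smooth_map f"
  shows "dbar_canon J (\<lambda>p v. f p * \<Omega> p v) p = (\<lambda>(u, t). (dbf f p u + f p * \<theta> p u) * \<Omega> p t)"
proof -
  let ?\<sigma> = "\<lambda>(u, t). (dbf f p u + f p * \<theta> p u) * \<Omega> p t"
  have wedge_map_\<Omega>: "wedge_map (Suc n) (\<lambda>(u, t). \<beta> u * \<Omega> p t) = wedge_list (Suc (Suc n)) (case_nat \<beta> (\<alpha>_at p))" for \<beta>
    unfolding \<Omega>_def by (rule wedge_map_wedge_list)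
  have "inj_on (wedge_map (Suc n)) (valued01 (J p) (canon (J p)))"
  proof (rule inj_onI)
    fix \<sigma> \<tau> assume \<sigma>: "\<sigma> \<in> valued01 (J p) (canon (J p))" and \<tau>: "\<tau> \<in> valued01 (J p) (canon (J p))"
      and eq: "wedge_map (Suc n) \<sigma> = wedge_map (Suc n) \<tau>"
    obtain \<beta> where \<beta>: "\<beta> \<in> forms01 (J p)" "\<sigma> = (\<lambda>(u, t). \<beta> u * \<Omega> p t)" using valued01_eq[OF \<sigma>] .
    obtain \<gamma> where \<gamma>: "\<gamma> \<in> forms01 (J p)" "\<tau> = (\<lambda>(u, t). \<gamma> u * \<Omega> p t)" using valued01_eq[OF \<tau>] .
    have "(\<lambda>u. \<beta> u + - 1 * \<gamma> u) \<in> forms01 (J p)"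
      by (intro forms01_add forms01_scale \<beta> \<gamma>)
    moreover have "wedge_list (Suc (Suc n)) (case_nat (\<lambda>u. \<beta> u + - 1 * \<gamma> u) (\<alpha>_at p)) v = 0" for v
    proof -
      have "wedge_list (Suc (Suc n)) (case_nat \<beta> (\<alpha>_at p)) v = wedge_list (Suc (Suc n)) (case_nat \<gamma> (\<alpha>_at p)) v"
        using eq by (simp only: \<beta>(2) \<gamma>(2) wedge_map_\<Omega>)
      then show ?thesis
        unfolding wedge_list_case_nat[of "Suc n"] by (simp add: algebra_simps sum_subtractf del: sum.atMost_Suc)
    qed
    ultimately have "\<beta> u + - 1 * \<gamma> u = 0" for u
      by (rule wedge_01_\<Omega>_eq_0)
    then have "\<beta> = \<gamma>" by (simp add: fun_eq_iff)
    then show "\<sigma> = \<tau>" by (simp only: \<beta>(2) \<gamma>(2))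
  qed
  moreover have "?\<sigma> \<in> valued01 (J p) (canon (J p))"
  proof -
    have "(\<lambda>u. dbf f p u + f p * \<theta> p u) \<in> forms01 (J p)"
      by (intro forms01_add forms01_scale dbf_01 f \<theta>_01)
    then show ?thesis
      unfolding valued01_def
      by (intro cfun.span_base CollectI exI[of _ "\<lambda>u. dbf f p u + f p * \<theta> p u"] exI[of _ "\<Omega> p"]
          conjI refl \<Omega>_in_canon)
  qed
  moreover have "wedge_map (Suc n) ?\<sigma> = dbar J (Suc n) 0 (\<lambda>p v. f p * \<Omega> p v) p"
    using type_part_ext_deriv_\<Omega>[OF f, of p] unfolding wedge_map_\<Omega> dbar_def by simp
  ultimately show ?thesis
    unfolding dbar_canon_def DIM_kt n[symmetric] by (intro the_inv_into_f_eq)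
qed

section \<open>Pluricanonical sections\<close>

lemma smooth_coord_J: "smooth_map (\<lambda>p. xcoord i (J p u))" "smooth_map (\<lambda>p. ycoord i (J p u))"
  by (rule smooth_map_compose_bounded_linear[OF _ smooth_J],
      simp add: linear_coord linear_conv_bounded_linear[symmetric])+

lemma smooth_half: "smooth_map f \<Longrightarrow> smooth_map g \<Longrightarrow> smooth_map (\<lambda>p. (f p + c * g p) / 2 :: complex)"
  using smooth_map_mult[of "\<lambda>p. f p + c * g p" "\<lambda>p. 1 / 2"]
  by (simp add: smooth_map_add smooth_map_mult)

lemma smooth_\<theta>: "smooth_map (\<lambda>p. \<theta> p u)"
proof -
  have *: "smooth_map (\<lambda>p. part10 (J p) (xcoord i) u)" "smooth_map (\<lambda>p. part10 (J p) (ycoord i) u)"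
    "smooth_map (\<lambda>p. part01 (J p) (xcoord i) u)" "smooth_map (\<lambda>p. part01 (J p) (ycoord i) u)" for u i
    using smooth_half[OF smooth_map_const smooth_coord_J(1), of _ "- \<i>"]
      smooth_half[OF smooth_map_const smooth_coord_J(2), of _ "- \<i>"]
      smooth_half[OF smooth_map_const smooth_coord_J(1)] smooth_half[OF smooth_map_const smooth_coord_J(2)]
    by (simp_all add: part10_def part01_def)
  have "smooth_map (\<lambda>p. \<Sum>i\<in>UNIV. part10 (J p) (xcoord i) fibre * part01 (J p) (ycoord i) u +
      - 1 * (part10 (J p) (ycoord i) fibre * part01 (J p) (xcoord i) u))"
    by (intro smooth_map_sum smooth_map_add smooth_map_mult smooth_map_const *)
  then show ?thesis by (simp add: \<theta>_def)
qed

lemma smooth_dbf: "smooth_map f \<Longrightarrow> smooth_map (\<lambda>p. dbf f p u)"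
  unfolding dbf_def part01_def
  by (intro smooth_half smooth_map_frechet_derivative smooth_map_frechet_derivative_along smooth_J)

lemma dbf_kt_mult:
  assumes "smooth_fun KT f" "g \<in> kt_lattice"
  shows "dbf f (kt_mult g p) (frame g u) = dbf f p u"
  using assms by (simp add: dbf_def part01_def J_frame_lattice frechet_derivative_invariant)

lemma dbf_add:
  assumes "smooth_map f" "smooth_map g"
  shows "dbf (\<lambda>p. f p + g p) p u = dbf f p u + dbf g p u"
proof -
  have "((\<lambda>p. f p + g p) has_derivative (\<lambda>u. \<d> f p u + \<d> g p u)) (at p)"
    using assms by (intro has_derivative_add smooth_map_has_derivative)
  from frechet_derivative_at[OF this, symmetric] show ?thesis
    by (simp add: dbf_def part01_def field_simps)
qed

lemma dbf_mult:
  assumes "smooth_map f" "smooth_map g"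
  shows "dbf (\<lambda>p. f p * g p) p u = f p * dbf g p u + dbf f p u * g p"
proof -
  have "((\<lambda>p. f p * g p) has_derivative (\<lambda>u. f p * \<d> g p u + \<d> f p u * g p)) (at p)"
    using assms by (intro has_derivative_mult smooth_map_has_derivative)
  from frechet_derivative_at[OF this, symmetric] show ?thesis
    by (simp add: dbf_def part01_def field_simps)
qed

lemma dbf_prod:
  assumes "\<And>i. i \<in> I \<Longrightarrow> smooth_map (f i)"
  shows "dbf (\<lambda>p. \<Prod>i\<in>I. f i p) p u = (\<Sum>i\<in>I. dbf (f i) p u * (\<Prod>l\<in>I - {i}. f l p))"
proof -
  have "((\<lambda>p. \<Prod>i\<in>I. f i p) has_derivative (\<lambda>u. \<Sum>i\<in>I. \<d> (f i) p u * (\<Prod>l\<in>I - {i}. f l p))) (at p)"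
    using assms by (intro has_derivative_prod smooth_map_has_derivative)
  from frechet_derivative_at[OF this, symmetric] show ?thesis
    by (simp add: dbf_def part01_def sum_distrib_left sum.distrib[symmetric] sum_divide_distrib algebra_simps
        add_divide_distrib)
qed

section \<open>Existence and uniqueness of the Leibniz extension\<close>

text \<open>The operator taking f to dbar f + N f \<theta>, written for sections f \<Omega>^N. The
  coefficient f is recovered by evaluating at \<open>e\<close> in every block.\<close>

definition dbar_N :: "nat \<Rightarrow> ('n kt \<Rightarrow> (nat \<Rightarrow> nat \<Rightarrow> 'n kt) \<Rightarrow> complex) \<Rightarrow>
    'n kt \<Rightarrow> 'n kt \<times> (nat \<Rightarrow> nat \<Rightarrow> 'n kt) \<Rightarrow> complex"
  where "dbar_N N s = (\<lambda>p (u, w).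
    (dbf (\<lambda>p. s p (\<lambda>i. e)) p u + of_nat N * s p (\<lambda>i. e) * \<theta> p u) * \<Omega>_pow N p w)"

lemma dbar_N_\<Omega>_pow:
  "dbar_N N (\<lambda>p w. f p * \<Omega>_pow N p w) =
    (\<lambda>p (u, w). (dbf f p u + of_nat N * f p * \<theta> p u) * \<Omega>_pow N p w)"
  by (simp add: dbar_N_def)

lemma dbar_N_in_sections:
  assumes f: "smooth_fun KT f"
  shows "dbar_N N (\<lambda>p w. f p * \<Omega>_pow N p w) \<in> pluricanon_sections01 KT J N"
proof -
  let ?\<beta> = "\<lambda>p u. dbf f p u + of_nat N * f p * \<theta> p u"
  have sf: "smooth_map f" using f by (simp add: smooth_fun_def)
  have "(\<lambda>(u, w). ?\<beta> p u * \<Omega>_pow N p w) \<in> valued01 (J p) (canon_pow N (J p))" for p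
    unfolding valued01_def
    by (intro cfun.span_base CollectI exI[of _ "?\<beta> p"] exI[of _ "\<Omega>_pow N p"] conjI refl
        \<Omega>_pow_in_canon_pow forms01_add forms01_scale dbf_01 sf \<theta>_01)
  moreover have "smooth_map (\<lambda>p. ?\<beta> p u * \<Omega>_pow N p w)" for u w
    by (intro smooth_map_mult smooth_map_add smooth_map_const smooth_dbf smooth_\<theta> smooth_\<Omega>_pow sf)
  moreover have "?\<beta> (kt_mult g p) (frame g u) * \<Omega>_pow N (kt_mult g p) (act_blocks (frame g) w) = ?\<beta> p u * \<Omega>_pow N p w"
    if "g \<in> kt_lattice" for g p u w
    using that f by (auto simp: dbf_kt_mult \<theta>_kt_mult smooth_fun_def KT_def)
  ultimately show ?thesis
    unfolding dbar_N_\<Omega>_pow pluricanon_sections01_def smooth_section_def act_valued_def KT_def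
    by (auto split: prod.splits)
qed

text \<open>The algebra of the Leibniz rule for a product of sections f_i \<Omega>: \<open>y\<close>
  stands for the f_i, \<open>a\<close> for their dbar, \<open>c\<close> for \<theta> and
  \<open>x\<close> for the values of \<Omega>. Each factor contributes \<open>c\<close> once, whence
  the multiple \<open>N\<close>.\<close>

lemma sum_omit_factor:
  fixes x y :: "nat \<Rightarrow> complex"
  shows "(\<Sum>i<N. (a i + y i * c) * x i * (\<Prod>l\<in>{..<N} - {i}. y l * x l)) =
    ((\<Sum>i<N. a i * (\<Prod>l\<in>{..<N} - {i}. y l)) + of_nat N * (\<Prod>i<N. y i) * c) * (\<Prod>i<N. x i)"
proof -
  have "(a i + y i * c) * x i * (\<Prod>l\<in>{..<N} - {i}. y l * x l) =
      (a i * (\<Prod>l\<in>{..<N} - {i}. y l) + (\<Prod>i<N. y i) * c) * (\<Prod>i<N. x i)" if "i < N" for i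
  proof -
    have r: "(\<Prod>i<N. y i) = y i * (\<Prod>l\<in>{..<N} - {i}. y l)" "(\<Prod>i<N. x i) = x i * (\<Prod>l\<in>{..<N} - {i}. x l)"
      using that by (auto intro: prod.remove)
    show ?thesis unfolding r by (simp add: prod.distrib algebra_simps)
  qed
  then have "(\<Sum>i<N. (a i + y i * c) * x i * (\<Prod>l\<in>{..<N} - {i}. y l * x l)) =
      (\<Sum>i<N. (a i * (\<Prod>l\<in>{..<N} - {i}. y l) + (\<Prod>i<N. y i) * c) * (\<Prod>i<N. x i))"
    by (intro sum.cong) auto
  then show ?thesis
    by (simp add: sum.distrib flip: sum_distrib_right)
qed

lemma leibniz_extension_dbar_N: "leibniz_extension KT J N (dbar_N N)"
  unfolding leibniz_extension_def
proof (intro conjI ballI allI impI)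
  fix s assume s: "s \<in> pluricanon_sections KT J N"
  show "dbar_N N s \<in> pluricanon_sections01 KT J N"
    by (subst pluricanon_sectionsE(2)[OF s]) (rule dbar_N_in_sections[OF pluricanon_sectionsE(1)[OF s]])
  have ss: "smooth_map (\<lambda>p. s p (\<lambda>i. e))"
    using pluricanon_sectionsE(1)[OF s] by (simp add: smooth_fun_def)
  show "dbar_N N (s + s') = dbar_N N s + dbar_N N s'" if s': "s' \<in> pluricanon_sections KT J N" for s'
  proof -
    have "smooth_map (\<lambda>p. s' p (\<lambda>i. e))"
      using pluricanon_sectionsE(1)[OF s'] by (simp add: smooth_fun_def)
    then show ?thesis
      using ss by (simp add: dbar_N_def dbf_add fun_eq_iff algebra_simps split: prod.splits)
  qed
  show "dbar_N N (\<lambda>p w. f p * s p w) = (\<lambda>p (u, w). dbar_fun J f p u * s p w + f p * dbar_N N s p (u, w))"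
    if f: "smooth_fun KT f" for f
  proof -
    have sf: "smooth_map f" using f by (simp add: smooth_fun_def)
    have sp: "s p w = s p (\<lambda>i. e) * \<Omega>_pow N p w" for p w
      using fun_cong[OF fun_cong[OF pluricanon_sectionsE(2)[OF s]]] .
    have "dbar_N N (\<lambda>p w. f p * s p w) p (u, w) = dbar_fun J f p u * s p w + f p * dbar_N N s p (u, w)" for p u w
      unfolding dbar_N_def dbar_fun_dbf[OF sf] prod.case sp[of p w] dbf_mult[OF sf ss]
      by (simp add: algebra_simps)
    then show ?thesis by (intro ext) (simp only: split_paired_all prod.case)
  qed
next
  fix \<phi> assume \<phi>: "\<forall>i<N. \<phi> i \<in> canon_sections KT J"
  have "\<exists>f. smooth_fun KT f \<and> \<phi> i = (\<lambda>p v. f p * \<Omega> p v)" if "i < N" for i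
    using \<phi> that canon_sectionsE by blast
  then obtain f where f: "\<And>i. i < N \<Longrightarrow> smooth_fun KT (f i)" "\<And>i. i < N \<Longrightarrow> \<phi> i = (\<lambda>p v. f i p * \<Omega> p v)"
    by metis
  then have sf: "smooth_map (f i)" if "i < N" for i
    using that by (simp add: smooth_fun_def)
  have "dbar_N N (\<lambda>p. tensor N (\<lambda>i. \<phi> i p)) p (u, w) =
      (\<Sum>i<N. dbar_canon J (\<phi> i) p (u, w i) * (\<Prod>l\<in>{..<N} - {i}. \<phi> l p (w l)))" for p u w
  proof -
    have "(\<lambda>p. tensor N (\<lambda>i. \<phi> i p)) = (\<lambda>p w. (\<Prod>i<N. f i p) * \<Omega>_pow N p w)"
      by (simp add: tensor_def[abs_def] \<Omega>_pow_def f prod.distrib)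
    moreover have "dbf (\<lambda>p. \<Prod>i<N. f i p) p u = (\<Sum>i<N. dbf (f i) p u * (\<Prod>l\<in>{..<N} - {i}. f l p))"
      by (rule dbf_prod) (simp add: sf)
    ultimately have "dbar_N N (\<lambda>p. tensor N (\<lambda>i. \<phi> i p)) p (u, w) =
        ((\<Sum>i<N. dbf (f i) p u * (\<Prod>l\<in>{..<N} - {i}. f l p)) + of_nat N * (\<Prod>i<N. f i p) * \<theta> p u) * (\<Prod>i<N. \<Omega> p (w i))"
      by (simp only: dbar_N_\<Omega>_pow prod.case) (simp add: \<Omega>_pow_def tensor_def)
    also have "\<dots> = (\<Sum>i<N. (dbf (f i) p u + f i p * \<theta> p u) * \<Omega> p (w i) * (\<Prod>l\<in>{..<N} - {i}. f l p * \<Omega> p (w l)))"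
      by (rule sum_omit_factor[symmetric])
    also have "\<dots> = (\<Sum>i<N. dbar_canon J (\<phi> i) p (u, w i) * (\<Prod>l\<in>{..<N} - {i}. \<phi> l p (w l)))"
      using sf by (intro sum.cong arg_cong2[of _ _ _ _ "(*)"] prod.cong) (auto simp: f dbar_canon_\<Omega>)
    finally show ?thesis .
  qed
  then show "dbar_N N (\<lambda>p. tensor N (\<lambda>i. \<phi> i p)) =
      (\<lambda>p (u, w). \<Sum>i<N. dbar_canon J (\<phi> i) p (u, w i) * (\<Prod>l\<in>{..<N} - {i}. \<phi> l p (w l)))"
    by (intro ext) (simp only: split_paired_all prod.case)
qed

text \<open>The power of \<Omega> is a pure tensor of global sections, so the tensor clause fixes
  its image; the Leibniz clause then fixes that of every f \<Omega>^N, and these are all the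
  sections.\<close>

lemma leibniz_extension_unique:
  assumes D: "leibniz_extension KT J N D" and f: "smooth_fun KT f"
  shows "D (\<lambda>p w. f p * \<Omega>_pow N p w) = dbar_N N (\<lambda>p w. f p * \<Omega>_pow N p w)"
proof -
  have one: "smooth_fun KT (\<lambda>p. 1)"
    by (simp add: smooth_fun_def)
  have tens: "\<forall>\<phi>. (\<forall>i<N. \<phi> i \<in> canon_sections KT J) \<longrightarrow> D (\<lambda>p. tensor N (\<lambda>i. \<phi> i p)) =
      (\<lambda>p (u, w). \<Sum>i<N. dbar_canon J (\<phi> i) p (u, w i) * (\<Prod>l\<in>{..<N} - {i}. \<phi> l p (w l)))"
    and leib: "\<forall>f. \<forall>s\<in>pluricanon_sections KT J N. smooth_fun KT f \<longrightarrow>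
      D (\<lambda>p w. f p * s p w) = (\<lambda>p (u, w). dbar_fun J f p u * s p w + f p * D s p (u, w))"
    using D unfolding leibniz_extension_def by blast+
  have \<Omega>: "\<Omega> \<in> canon_sections KT J" and \<Omega>N: "\<Omega>_pow N \<in> pluricanon_sections KT J N"
    using canon_sectionsI[OF one] pluricanon_sectionsI[OF one] by simp_all
  have "dbf (\<lambda>p. 1) p u = 0" for p u
    by (simp add: dbf_def part01_def)
  then have db\<Omega>: "dbar_canon J \<Omega> p (u, t) = \<theta> p u * \<Omega> p t" for p u t
    using dbar_canon_\<Omega>[of "\<lambda>p. 1" p] by simp
  have "D (\<Omega>_pow N) = (\<lambda>p (u, w). \<Sum>i<N. dbar_canon J \<Omega> p (u, w i) * (\<Prod>l\<in>{..<N} - {i}. \<Omega> p (w l)))"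
    using tens[rule_format, of "\<lambda>i. \<Omega>"] \<Omega> by (simp add: \<Omega>_pow_def[abs_def])
  also have "\<dots> = (\<lambda>p (u, w). of_nat N * \<theta> p u * \<Omega>_pow N p w)"
    using sum_omit_factor[of "\<lambda>i. 0" "\<lambda>i. 1"] by (simp add: db\<Omega> \<Omega>_pow_def tensor_def)
  finally have D\<Omega>: "D (\<Omega>_pow N) = (\<lambda>p (u, w). of_nat N * \<theta> p u * \<Omega>_pow N p w)" .
  have "D (\<lambda>p w. f p * \<Omega>_pow N p w) =
      (\<lambda>p (u, w). dbar_fun J f p u * \<Omega>_pow N p w + f p * D (\<Omega>_pow N) p (u, w))"
    using leib[rule_format, OF \<Omega>N f] .
  then show ?thesis
    using f unfolding D\<Omega> dbar_N_\<Omega>_pow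
    by (simp add: dbar_fun_dbf smooth_fun_def algebra_simps)
qed

definition solutions :: "nat \<Rightarrow> ('n kt \<Rightarrow> complex) set"
  where "solutions N = {f. smooth_fun KT f \<and> (\<forall>p u. dbf f p u + of_nat N * f p * \<theta> p u = 0)}"

lemma H0_eq: "H0 KT J N = (\<lambda>f p w. f p * \<Omega>_pow N p w) ` solutions N"
proof -
  \<comment> \<open>Existence makes the choice in \<open>dbar_pow\<close> a genuine Leibniz
    extension, to which uniqueness applies.\<close>
  have L: "leibniz_extension KT J N (dbar_pow KT J N)"
    unfolding dbar_pow_def using leibniz_extension_dbar_N[of N]
    by (rule someI[where P = "leibniz_extension KT J N"])
  have iff: "(\<lambda>p w. f p * \<Omega>_pow N p w) \<in> H0 KT J N \<longleftrightarrow> f \<in> solutions N" if f: "smooth_fun KT f" for f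
  proof -
    have "(\<lambda>p (u, w). (dbf f p u + of_nat N * f p * \<theta> p u) * \<Omega>_pow N p w) = 0 \<longleftrightarrow>
        (\<forall>p u. dbf f p u + of_nat N * f p * \<theta> p u = 0)" (is "?L = 0 \<longleftrightarrow> ?R")
    proof
      assume "?L = 0"
      from fun_cong[OF fun_cong[OF this], of _ "(_, \<lambda>i. e)"] show ?R by simp
    next
      assume ?R
      then show "?L = 0" by (simp add: fun_eq_iff)
    qed
    then show ?thesis
      using f pluricanon_sectionsI[OF f]
      by (simp add: H0_def solutions_def leibniz_extension_unique[OF L f] dbar_N_\<Omega>_pow)
  qed
  show ?thesis
  proof (intro equalityI subsetI)
    fix s assume s: "s \<in> H0 KT J N"
    then have "s \<in> pluricanon_sections KT J N" by (simp add: H0_def)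
    note f = pluricanon_sectionsE[OF this]
    have "(\<lambda>p. s p (\<lambda>i. e)) \<in> solutions N"
      using s by (subst iff[OF f(1), symmetric], subst f(2)[symmetric])
    then show "s \<in> (\<lambda>f p w. f p * \<Omega>_pow N p w) ` solutions N"
      by (rule image_eqI[rotated]) (rule f(2))
  next
    fix s assume "s \<in> (\<lambda>f p w. f p * \<Omega>_pow N p w) ` solutions N"
    then show "s \<in> H0 KT J N"
      using iff by (auto simp: solutions_def)
  qed
qed

section \<open>Solutions of the scalar equation\<close>

lemma fst_fibre: "fst fibre = 0" "fst (snd fibre) = 0"
  by (simp_all add: fibre_def)

lemma frechet_derivative_fibre_0:
  assumes f: "f \<in> solutions N"
  shows "\<d> f p fibre = 0"
proof -
  have sf: "smooth_map f" and bdd: "bounded (range f)" and eq: "dbf f q u + of_nat N * f q * \<theta> q u = 0" for q u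
    using f bounded_smooth_fun by (auto simp: solutions_def smooth_fun_def)
  define b where "b = J p fibre"
  define \<kappa> where "\<kappa> = inner (fst b) (fst (snd b))"
  \<comment> \<open>A parametrised leaf through \<open>p\<close> tangent to \<open>fibre\<close> and
    \<open>J fibre\<close>. The field \<open>J fibre\<close> changes along itself by the constant
    multiple \<kappa> of \<open>fibre\<close>, and integrating this produces the quadratic
    term.\<close>
  define \<gamma> where "\<gamma> w = p + (Re w *\<^sub>R fibre + (Im w *\<^sub>R b + ((Im w)\<^sup>2 / 2 * \<kappa>) *\<^sub>R fibre))" for w
  have J\<gamma>: "J (\<gamma> w) fibre = b + (Im w * \<kappa>) *\<^sub>R fibre" for w
  proof -
    have J: "J q fibre = frame q (J 0 fibre)" for q
      using J_frame[of q fibre] by simp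
    have 1: "fst (\<gamma> w) = fst p + Im w *\<^sub>R fst b"
      by (simp add: \<gamma>_def fibre_def)
    have 2: "fst b = fst (J 0 fibre)" "fst (snd b) = fst (snd (J 0 fibre))"
      by (simp_all add: b_def J[of p])
    show ?thesis
      unfolding J[of "\<gamma> w"] unfolding b_def J[of p] frame_def[of _ "J 0 fibre"] 1 \<kappa>_def 2
      by (simp add: fst_fibre inner_add_left algebra_simps)
  qed
  have "(\<gamma> has_derivative (\<lambda>h. Re h *\<^sub>R fibre + Im h *\<^sub>R J (\<gamma> w) fibre)) (at w)" for w
  proof -
    have "(\<gamma> has_derivative (\<lambda>h. 0 + (Re h *\<^sub>R fibre + (Im h *\<^sub>R b + (Im w * Im h * \<kappa>) *\<^sub>R fibre)))) (at w)"
      unfolding \<gamma>_def[abs_def] power2_eq_square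
      by (auto intro!: derivative_eq_intros bounded_linear_imp_has_derivative[OF bounded_linear_Re]
          bounded_linear_imp_has_derivative[OF bounded_linear_Im] simp: algebra_simps)
    then show ?thesis
      by (simp add: J\<gamma> algebra_simps)
  qed
  note D\<gamma> = this
  have D: "((\<lambda>w. f (\<gamma> w)) has_derivative (\<lambda>h. Re h *\<^sub>R \<d> f (\<gamma> w) fibre + Im h *\<^sub>R \<d> f (\<gamma> w) (J (\<gamma> w) fibre))) (at w)" for w
  proof -
    have L: "linear (\<d> f q)" for q
      using sf by (intro linear_frechet_derivative smooth_map_differentiable)
    show ?thesis
      using has_derivative_compose[OF D\<gamma> smooth_map_has_derivative[OF sf]]
      by (simp add: linear_add[OF L] linear_scale[OF L])
  qed
  \<comment> \<open>Since \<theta> vanishes on \<open>fibre\<close>, the equation in this direction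
    is the untwisted one.\<close>
  have "\<d> f q fibre + \<i> * \<d> f q (J q fibre) = 0" for q
    using eq[of q fibre] by (simp add: \<theta>_fibre dbf_def part01_def)
  moreover have "bounded (range (\<lambda>w. f (\<gamma> w)))"
    using bdd by (rule bounded_subset) auto
  ultimately have "f (\<gamma> w) = f (\<gamma> 0)" for w
    by (intro bounded_cauchy_riemann_constant[OF D])
  then have "(\<lambda>w. f (\<gamma> w)) = (\<lambda>w. f (\<gamma> 0))"
    by (intro ext)
  then have "((\<lambda>w. f (\<gamma> w)) has_derivative (\<lambda>h. 0)) (at 0)"
    by simp
  from fun_cong[OF has_derivative_unique[OF D this], of 1] show ?thesis
    by (simp add: \<gamma>_def)
qed

text \<open>The exponential factor of the twisted Liouville argument at w = 1; its exponent is
  purely imaginary.\<close>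

definition character :: "nat \<Rightarrow> 'n kt \<Rightarrow> complex"
  where "character N v = (let c = - 2 * of_nat N * \<theta> 0 v in exp ((c - cnj c) / 2))"

text \<open>Once df kills \<open>fibre\<close>, it no longer sees \<open>frame\<close>, and straight
  planes spanned by \<open>v\<close> and \<open>J 0 v\<close> can replace curved leaves.\<close>

lemma solution_eq_character:
  assumes f: "f \<in> solutions N"
  shows "f v = f 0 * character N v"
proof -
  have sf: "smooth_map f" and bdd: "bounded (range f)" and eq: "dbf f q u + of_nat N * f q * \<theta> q u = 0" for q u
    using f bounded_smooth_fun by (auto simp: solutions_def smooth_fun_def)
  have L: "linear (\<d> f q)" for q
    using sf by (intro linear_frechet_derivative smooth_map_differentiable)
  have flat: "\<d> f q (frame q u) = \<d> f q u" for q u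
    by (simp add: frame_def linear_add[OF L] linear_scale[OF L] frechet_derivative_fibre_0[OF f])
  define \<gamma> where "\<gamma> w = Re w *\<^sub>R v + Im w *\<^sub>R J 0 v" for w
  define c where "c = - 2 * of_nat N * \<theta> 0 v"
  have "bounded_linear \<gamma>"
    unfolding \<gamma>_def[abs_def]
    by (intro bounded_linear_add bounded_linear_scaleR_const bounded_linear_Re bounded_linear_Im)
  then have "(\<gamma> has_derivative \<gamma>) (at w)" for w
    by (rule bounded_linear_imp_has_derivative)
  from has_derivative_compose[OF this smooth_map_has_derivative[OF sf]]
  have "((\<lambda>w. f (\<gamma> w)) has_derivative (\<lambda>h. Re h *\<^sub>R \<d> f (\<gamma> w) v + Im h *\<^sub>R \<d> f (\<gamma> w) (J 0 v))) (at w)" for w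
    by (simp add: \<gamma>_def linear_add[OF L] linear_scale[OF L])
  moreover have "\<d> f q v + \<i> * \<d> f q (J 0 v) = c * f q" for q
  proof -
    \<comment> \<open>The equation is tested on the invariant field through \<open>v\<close>, where
      \<theta> has the constant value \<open>\<theta> 0 v\<close>.\<close>
    have "dbf f q (frame q v) = (\<d> f q v + \<i> * \<d> f q (J 0 v)) / 2"
      by (simp add: dbf_def part01_def J_frame flat)
    then have "(\<d> f q v + \<i> * \<d> f q (J 0 v)) / 2 + of_nat N * f q * \<theta> 0 v = 0"
      using eq[of q "frame q v"] by (simp only: \<theta>_frame)
    moreover have "x = - 2 * of_nat N * \<theta> 0 v * f q" if "x / 2 + of_nat N * f q * \<theta> 0 v = 0" for x
      using that by (simp add: field_simps add_eq_0_iff2)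
    ultimately show ?thesis
      unfolding c_def by blast
  qed
  moreover have "bounded (range (\<lambda>w. f (\<gamma> w)))"
    using bdd by (rule bounded_subset) auto
  ultimately have "f (\<gamma> 1) = f (\<gamma> 0) * exp ((c * cnj 1 - cnj c * 1) / 2)"
    by (rule bounded_twisted_cauchy_riemann)
  then show ?thesis
    by (simp add: \<gamma>_def character_def c_def Let_def)
qed

text \<open>By the product rule the twist of a power is the twist of \<open>f\<close> taken
  \<open>m\<close> times, matching \<open>m * N\<close>.\<close>

lemma solutions_power:
  assumes f: "f \<in> solutions N"
  shows "(\<lambda>p. f p ^ m) \<in> solutions (m * N)"
proof -
  have sf: "smooth_map f" and inv: "smooth_fun KT f" and eq: "dbf f p u = - (of_nat N * f p * \<theta> p u)" for p u
    using f by (auto simp: solutions_def smooth_fun_def eq_neg_iff_add_eq_0)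
  have "smooth_map (\<lambda>p. f p ^ m) \<and> (\<forall>p u. dbf (\<lambda>p. f p ^ m) p u = - (of_nat (m * N) * f p ^ m * \<theta> p u))"
  proof (induction m)
    case 0
    show ?case by (simp add: dbf_def part01_def)
  next
    case (Suc m)
    then have "dbf (\<lambda>p. f p ^ Suc m) p u = - (of_nat (Suc m * N) * f p ^ Suc m * \<theta> p u)" for p u
      using dbf_mult[OF sf, of "\<lambda>p. f p ^ m" p u] by (simp add: eq algebra_simps)
    then show ?case
      using smooth_map_mult[OF sf, of "\<lambda>p. f p ^ m"] Suc by simp
  qed
  then show ?thesis
    using inv by (simp add: solutions_def smooth_fun_def)
qed

section \<open>The Kodaira dimension\<close>

text \<open>By the character formula a solution vanishing at the origin vanishes identically, so
  this says that a nonzero solution exists.\<close>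

definition effective :: "nat \<Rightarrow> bool"
  where "effective N \<longleftrightarrow> (\<exists>f\<in>solutions N. f 0 \<noteq> 0)"

lemma effective_mult:
  assumes "effective N"
  shows "effective (m * N)"
proof -
  obtain f where f: "f \<in> solutions N" "f 0 \<noteq> 0"
    using assms by (auto simp: effective_def)
  then show ?thesis
    unfolding effective_def by (intro bexI[OF _ solutions_power[OF f(1), of m]]) simp
qed

lemma plurigenus_eq: "plurigenus KT J N = (if effective N then 1 else 0)"
proof (cases "effective N")
  case True
  then obtain f where f: "f \<in> solutions N" "f 0 \<noteq> 0"
    by (auto simp: effective_def)
  define s where "s = (\<lambda>p w. f p * \<Omega>_pow N p w)"
  have "s 0 (\<lambda>i. e) \<noteq> 0"
    using f(2) by (simp add: s_def)
  then have "s \<noteq> 0" by auto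
  then have ind: "cfun2.independent {s}" by simp
  have sub: "H0 KT J N \<subseteq> cfun2.span {s}"
  proof
    fix s' assume "s' \<in> H0 KT J N"
    then obtain h where h: "h \<in> solutions N" "s' = (\<lambda>p w. h p * \<Omega>_pow N p w)"
      by (auto simp: H0_eq)
    \<comment> \<open>Both solutions carry the same character, which drops out of their
      ratio.\<close>
    have eq: "h p = h 0 / f 0 * f p" for p
      unfolding solution_eq_character[OF h(1), of p] solution_eq_character[OF f(1), of p]
      using f(2) by simp
    have "s' = cscale2 (h 0 / f 0) s"
      unfolding h(2) s_def cscale2_def mult.assoc[symmetric] eq[symmetric] by (rule refl)
    then show "s' \<in> cfun2.span {s}"
      using cfun2.span_scale[OF cfun2.span_base[of s "{s}"]] by simp
  qed
  have "s \<in> H0 KT J N"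
    using f(1) by (auto simp: H0_eq s_def)
  then have "cfun2.span {s} \<subseteq> cfun2.span (H0 KT J N)"
    by (intro cfun2.span_mono) simp
  moreover have "cfun2.span (H0 KT J N) \<subseteq> cfun2.span {s}"
    using sub by (simp add: cfun2.span_minimal)
  ultimately have "cfun2.dim (H0 KT J N) = card {s}"
    by (intro cfun2.dim_eq_card[OF _ ind]) auto
  moreover have "\<exists>B. finite B \<and> H0 KT J N \<subseteq> cfun2.span B"
    using sub by (intro exI[of _ "{s}"]) simp
  ultimately show ?thesis
    using True by (simp add: plurigenus_def one_enat_def)
next
  case False
  have "s = 0" if "s \<in> H0 KT J N" for s
  proof -
    obtain f where f: "f \<in> solutions N" "s = (\<lambda>p w. f p * \<Omega>_pow N p w)"
      using \<open>s \<in> H0 KT J N\<close> unfolding H0_eq by blast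
    then have "f p = 0" for p
      using solution_eq_character[OF f(1), of p] False by (auto simp: effective_def)
    then show ?thesis by (simp add: f(2) fun_eq_iff)
  qed
  then have sub: "H0 KT J N \<subseteq> cfun2.span {}"
    by auto
  then have "cfun2.span (H0 KT J N) = cfun2.span {}"
    using cfun2.span_minimal[OF sub] cfun2.span_mono[of "{}" "H0 KT J N"] by blast
  then have "cfun2.dim (H0 KT J N) = card ({} :: ('n kt \<Rightarrow> (nat \<Rightarrow> nat \<Rightarrow> 'n kt) \<Rightarrow> complex) set)"
    by (intro cfun2.dim_eq_card cfun2.independent_empty) simp
  moreover have "\<exists>B. finite B \<and> H0 KT J N \<subseteq> cfun2.span B"
    using sub by (intro exI[of _ "{}"]) simp
  ultimately show ?thesis
    using False by (simp add: plurigenus_def zero_enat_def)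
qed

lemma kodaira_dim_cases: "kodaira_dim KT J = 0 \<or> kodaira_dim KT J = - \<infinity>"
proof (cases "\<forall>N\<ge>1. plurigenus KT J N = 0")
  case True
  then show ?thesis by (simp add: kodaira_dim_def)
next
  case False
  then obtain M where M: "M \<ge> 1" "effective M"
    by (auto simp: plurigenus_eq split: if_splits)
  define X where "X N = log_enat (plurigenus KT J N) / ereal (ln (real N))" for N
  have X: "X N = (if effective N then 0 else - \<infinity> / ereal (ln (real N)))" for N
    by (simp add: X_def plurigenus_eq log_enat_def one_enat_def zero_enat_def flip: zero_ereal_def)
  \<comment> \<open>From N = 2 on the denominator ln N is positive, so a vanishing plurigenus
    contributes minus infinity; finitely many terms do not affect the limsup.\<close>
  have "X N \<le> 0" if "N \<ge> 2" for N
    using that by (simp add: X)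
  then have "limsup X \<le> 0"
    by (intro Limsup_bounded) (auto simp: eventually_sequentially)
  moreover have "0 \<le> limsup X"
  proof -
    \<comment> \<open>Along the positive multiples of the effective \<open>M\<close> the quotient is
      constantly 0, which bounds the limsup from below.\<close>
    have "strict_mono (\<lambda>m. Suc m * M)"
      using M by (intro strict_monoI) simp
    then have "limsup (X \<circ> (\<lambda>m. Suc m * M)) \<le> limsup X"
      by (rule limsup_subseq_mono)
    moreover have "X \<circ> (\<lambda>m. Suc m * M) = (\<lambda>m. 0)"
      using effective_mult[OF M(2)] by (auto simp: X simp del: mult_Suc)
    ultimately show ?thesis
      by (simp add: Limsup_const)
  qed
  ultimately show ?thesis
    using False by (simp add: kodaira_dim_def X_def[abs_def])
qed

end

theorem theorem4p1:
  fixes J :: "'n::finite kt \<Rightarrow> 'n kt \<Rightarrow> 'n kt"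
  assumes "left_invariant_acs J"
  shows "kodaira_dim KT J = 0 \<or> kodaira_dim KT J = - \<infinity>"
proof -
  have J: "linear (J 0)" "\<And>v. J 0 (J 0 v) = - v"
    using assms unfolding left_invariant_acs_def almost_complex_structure_def by blast+
  have "(fibre :: 'n kt) \<noteq> 0"
    by (simp add: fibre_def zero_prod_def)
  from J this show ?thesis
  \<comment> \<open>The basis is started with the nonzero vector \<open>fibre\<close>, as the
    normalisation \<open>e 0 = fibre\<close> of the locale demands.\<close>
  proof (rule complex_structure_basis[where 'v = "'n kt", unfolded DIM_kt])
    fix e :: "nat \<Rightarrow> 'n kt" and \<alpha>
    assume "e 0 = fibre"
      "\<And>i. i < Suc CARD('n) \<Longrightarrow> \<alpha> i \<in> forms10 (J 0)"
      "\<And>i l. i < Suc CARD('n) \<Longrightarrow> l < Suc CARD('n) \<Longrightarrow> \<alpha> i (e l) = (if i = l then 1 else 0)"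
      "\<And>\<beta> v. \<beta> \<in> forms10 (J 0) \<Longrightarrow> \<beta> v = (\<Sum>i<Suc CARD('n). \<beta> (e i) * \<alpha> i v)"
    then interpret kt_acs J e \<alpha> "CARD('n)"
      by unfold_locales (use assms in auto)
    show ?thesis by (rule kodaira_dim_cases)
  qed
qed

end
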